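(* Let $M$ be a compact 3-manifold with non-empty boundary which has an infinite cyclic cover, let $\mathcal T$ be an ideal triangulation of its interior, and let $c$ be a Ptolemy assignment on $\mathcal T$. The 1-loop polynomial $\delta_{\mathcal T,c,2}(t)$ is invariant under 2--3 Pachner moves. That is, if $\mathcal T'$ is obtained from $\mathcal T$ by replacing two tetrahedra $[0,2,3,4]$ and $[1,2,3,4]$ with common face $[2,3,4]$ by the three tetrahedra $[0,1,2,3]$, $[0,1,3,4]$, $[0,1,2,4]$, and $c$ also denotes the Ptolemy assignment on $\mathcal T'$ that agrees with the given one on the edges of $\mathcal T$, then $$\delta_{\mathcal T,c,2}(t)=\delta_{\mathcal T',c,2}(t).$$
   Context: Ptolemy assignment: $\mathcal T^1$ denotes the oriented edges and $\mathcal T^2$ the unoriented faces of $\mathcal T$. Each tetrahedron has its vertices ordered $0,1,2,3$, the orderings being respected by the face-gluings (this ordering condition can be relaxed). A Ptolemy assignment is a map $c:\mathcal T^1\to\mathbb C^\ast$ with $c(-e)=-c(e)$ and, for each tetrahedron, $c_{01}c_{23}-c_{02}c_{13}+c_{03}c_{12}=0$, where $c_{ij}=c([i,j])$. Face-equations: for a tetrahedron $\Delta$ with vertices $0,1,2,3$ let $f_k$ be the face opposite to vertex $k$, and let $\theta_k=\theta(f_k)$ where $\theta:\mathcal T^2\to\mathbb C$ is unknown. The four face-equations of $\Delta$, one for each face, are $E_{\Delta,f_3}: c_{12}\theta_0-c_{02}\theta_1+c_{01}\theta_2=0$, $E_{\Delta,f_2}: c_{13}\theta_0-c_{03}\theta_1+c_{01}\theta_3=0$,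 $E_{\Delta,f_1}: c_{23}\theta_0-c_{03}\theta_2+c_{02}\theta_3=0$, $E_{\Delta,f_0}: c_{23}\theta_1-c_{13}\theta_2+c_{12}\theta_3=0$. Face-matrix: if $\mathcal T$ has $N$ tetrahedra, then it has $N$ edges and $2N$ faces. Choose an edge $e_\Delta$ of each tetrahedron $\Delta$ and keep only the two face-equations of $\Delta$ corresponding to the two faces of $\Delta$ that contain $e_\Delta$. The resulting $2N$ linear equations in the $2N$ unknowns $\theta(f)$ have a $2N\times 2N$ coefficient matrix $F_c$, the face-matrix. Twisting: let $\widetilde M$ be the infinite cyclic cover, with deck group identified with $\{t^k: k\in\mathbb Z\}$ for a formal variable $t$, and with the induced triangulation $\widetilde{\mathcal T}$. Choose a lift of every cell of $\mathcal T$ to $\widetilde{\mathcal T}$ (the lift of $f$ is denoted $\widetilde f$). If the lift of $\Delta$ has the faces $t^{k_i}\cdot\widetilde f_i$, replace $\theta(f_i)$ by $t^{k_i}\theta(f_i)$ in the face-equations of $\Delta$. The resulting coefficient matrix is the twisted face-matrix $F_c(t)$. 1-loop polynomial: with $c_1,\dots,c_N$ the values of $c$ on the $N$ edges, $$\delta_{\mathcal T,c,2}(t)=\frac{1}{c_1\cdots c_N}\Big(\prod_\Delta\frac{1}{c(e_\Delta)}\Big)\det F_c(t),$$ which does not depend on the choice of the edges $e_\Delta$. *)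

theory Defs
  imports
    "HOL-Analysis.Analysis"
    "HOL-Homology.Simplices"
    "HOL-Computational_Algebra.Formal_Laurent_Series"
    "Jordan_Normal_Form.Determinant"
begin

section \<open>Compact 3-manifolds with boundary\<close>

definition compact_3_manifold :: "'a::topological_space set \<Rightarrow> bool" where
  "compact_3_manifold M \<longleftrightarrow>
     compact M \<and> Hausdorff_space (top_of_set M) \<and> second_countable (top_of_set M) \<and>
     (\<forall>x\<in>M. \<exists>U V. openin (top_of_set M) U \<and> x \<in> U \<and>
        openin (top_of_set {y :: real \<times> real \<times> real. 0 \<le> fst y}) V \<and> U homeomorphic V)"

definition manifold_interior :: "'a::topological_space set \<Rightarrow> 'a set" where
  "manifold_interior M =
     {x\<in>M. \<exists>U. openin (top_of_set M) U \<and> x \<in> U \<and> U homeomorphic (UNIV :: (real \<times> real \<times> real) set)}"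

definition manifold_boundary :: "'a::topological_space set \<Rightarrow> 'a set" where
  "manifold_boundary M = M - manifold_interior M"


section \<open>Infinite cyclic covers\<close>

definition deck_transformations ::
  "'b::topological_space set \<Rightarrow> ('b \<Rightarrow> 'a) \<Rightarrow> ('b \<Rightarrow> 'b) set" where
  "deck_transformations Mt p =
     {g \<in> extensional Mt. (\<exists>h. homeomorphism Mt Mt g h) \<and> (\<forall>x\<in>Mt. p (g x) = p x)}"

text \<open>A connected regular cover whose deck group is identified with the integers;
  \<open>act k\<close> is the deck transformation written \<open>t\<close> to the power \<open>k\<close>.\<close>

definition infinite_cyclic_cover ::
  "'a::topological_space set \<Rightarrow> 'b::topological_space set \<Rightarrow> ('b \<Rightarrow> 'a) \<Rightarrow> (int \<Rightarrow> 'b \<Rightarrow> 'b) \<Rightarrow> bool" where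
  "infinite_cyclic_cover M Mt p act \<longleftrightarrow>
     covering_space Mt p M \<and> connected Mt \<and>
     bij_betw act UNIV (deck_transformations Mt p) \<and>
     (\<forall>j k. \<forall>x\<in>Mt. act (j + k) x = act j (act k x)) \<and>
     (\<forall>x\<in>Mt. \<forall>y\<in>Mt. p x = p y \<longrightarrow> (\<exists>k. y = act k x))"


section \<open>Ordered ideal triangulations\<close>

text \<open>An ideal simplex is a standard simplex without its vertices. An ordered ideal
  triangulation is encoded as a Delta-complex structure, that is, by the characteristic maps of
  its tetrahedra, each defined on the ideal 3-simplex with vertices 0, 1, 2, 3 and
  extensional outside it. The lower-dimensional cells are the restrictions of these maps to
  faces, parametrised in increasing vertex order, so that two faces (or edges) are glued together,
  respecting the vertex orderings, exactly when the two restrictions are the same map.\<close>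

type_synonym 'a simplex_map = "(nat \<Rightarrow> real) \<Rightarrow> 'a"

definition ideal_simplex :: "nat \<Rightarrow> (nat \<Rightarrow> real) set" where
  "ideal_simplex n = {x \<in> standard_simplex n. \<forall>i. x i < 1}"

definition open_simplex :: "nat \<Rightarrow> (nat \<Rightarrow> real) set" where
  "open_simplex n = {x \<in> standard_simplex n. \<forall>i\<le>n. 0 < x i}"

text \<open>\<open>subsimplex s [v\<^sub>0, \<dots>, v\<^sub>n]\<close> is the restriction of \<open>s\<close> to the simplex
  with vertices \<open>v\<^sub>0, \<dots>, v\<^sub>n\<close>, taken in this order (which need not be increasing).\<close>

definition subsimplex :: "'a simplex_map \<Rightarrow> nat list \<Rightarrow> 'a simplex_map" where
  "subsimplex s vs =
     restrict (\<lambda>x. s (\<lambda>v. \<Sum>i<length vs. if vs ! i = v then x i else 0))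
       (ideal_simplex (length vs - 1))"

abbreviation edge :: "'a simplex_map \<Rightarrow> nat \<Rightarrow> nat \<Rightarrow> 'a simplex_map" where
  "edge s i j \<equiv> subsimplex s [i, j]"

abbreviation face :: "'a simplex_map \<Rightarrow> nat \<Rightarrow> 'a simplex_map" where
  "face s k \<equiv> subsimplex s (remove1 k [0, 1, 2, 3])"

definition cells :: "nat \<Rightarrow> 'a simplex_map set \<Rightarrow> 'a simplex_map set" where
  "cells n T = {subsimplex s vs | s vs.
     s \<in> T \<and> sorted_wrt (<) vs \<and> set vs \<subseteq> {0, 1, 2, 3} \<and> length vs = n + 1}"

text \<open>The last condition says that the triangulation is obtained by gluing the faces of the
  tetrahedra in pairs.\<close>

definition ideal_triangulation :: "'a::topological_space set \<Rightarrow> 'a simplex_map set \<Rightarrow> bool" where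
  "ideal_triangulation X T \<longleftrightarrow>
     finite T \<and>
     (\<forall>s\<in>T. s \<in> extensional (ideal_simplex 3) \<and> continuous_on (ideal_simplex 3) s \<and>
        s ` ideal_simplex 3 \<subseteq> X) \<and>
     (\<forall>x\<in>X. \<exists>!(n, r, y). n \<in> {1, 2, 3} \<and> r \<in> cells n T \<and> y \<in> open_simplex n \<and> r y = x) \<and>
     (\<forall>U\<subseteq>X. openin (top_of_set X) U \<longleftrightarrow>
        (\<forall>s\<in>T. openin (top_of_set (ideal_simplex 3)) (ideal_simplex 3 \<inter> s -` U))) \<and>
     (\<forall>f\<in>cells 2 T. card {(s, k). s \<in> T \<and> k < 4 \<and> face s k = f} = 2)"


section \<open>Ptolemy assignments\<close>

text \<open>The oriented edges of \<open>T\<close> are the maps \<open>edge s i j\<close> with \<open>i \<noteq> j\<close>; values of \<open>c\<close>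
  at any other argument are irrelevant.\<close>

definition ptolemy_assignment :: "'a simplex_map set \<Rightarrow> ('a simplex_map \<Rightarrow> complex) \<Rightarrow> bool" where
  "ptolemy_assignment T c \<longleftrightarrow>
     (\<forall>s\<in>T. \<forall>i<4. \<forall>j<4. i \<noteq> j \<longrightarrow>
        c (edge s i j) \<noteq> 0 \<and> c (edge s j i) = - c (edge s i j)) \<and>
     (\<forall>s\<in>T. c (edge s 0 1) * c (edge s 2 3) - c (edge s 0 2) * c (edge s 1 3)
        + c (edge s 0 3) * c (edge s 1 2) = 0)"


section \<open>The twisted face-matrix and the 1-loop polynomial\<close>

text \<open>The coefficients of the unknowns \<open>\<theta>\<^sub>0, \<theta>\<^sub>1, \<theta>\<^sub>2, \<theta>\<^sub>3\<close> in the equation of the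
  tetrahedron \<open>s\<close> and its face \<open>k\<close>.\<close>

definition face_equation :: "('a simplex_map \<Rightarrow> complex) \<Rightarrow> 'a simplex_map \<Rightarrow> nat \<Rightarrow> complex list" where
  "face_equation c s k =
     (if k = 3 then [c (edge s 1 2), - c (edge s 0 2), c (edge s 0 1), 0]
      else if k = 2 then [c (edge s 1 3), - c (edge s 0 3), 0, c (edge s 0 1)]
      else if k = 1 then [c (edge s 2 3), 0, - c (edge s 0 3), c (edge s 0 2)]
      else [0, c (edge s 2 3), - c (edge s 1 3), c (edge s 1 2)])"

text \<open>\<open>L\<close> chooses a lift of every cell. The cells of the induced triangulation of the cover are
  the lifts of the characteristic maps.\<close>

definition cell_lifts ::
  "'b::topological_space set \<Rightarrow> ('b \<Rightarrow> 'a) \<Rightarrow> 'a simplex_map set \<Rightarrow> ('a simplex_map \<Rightarrow> 'b simplex_map) \<Rightarrow> bool" where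
  "cell_lifts Mt p T L \<longleftrightarrow>
     (\<forall>n\<in>{1, 2, 3}. \<forall>r\<in>cells n T. continuous_on (ideal_simplex n) (L r) \<and>
        (\<forall>x\<in>ideal_simplex n. L r x \<in> Mt \<and> p (L r x) = r x))"

definition twist ::
  "(int \<Rightarrow> 'b \<Rightarrow> 'b) \<Rightarrow> ('a simplex_map \<Rightarrow> 'b simplex_map) \<Rightarrow> 'a simplex_map \<Rightarrow> nat \<Rightarrow> int" where
  "twist act L s i =
     (THE k. \<forall>x\<in>ideal_simplex 2. face (L s) i x = act k (L (face s i) x))"

text \<open>The choices entering the face-matrix: an edge \<open>[i, j]\<close>, \<open>i < j\<close>, of every tetrahedron
  \<open>s\<close>, encoded as \<open>E s = (i, j)\<close>; lifts of the cells; an enumeration \<open>rs\<close> of the chosen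
  face-equations, where \<open>(s, k)\<close> stands for the equation of \<open>s\<close> and its face \<open>k\<close> (the face \<open>k\<close>
  contains the edge \<open>[i, j]\<close> iff \<open>k\<close> is neither \<open>i\<close> nor \<open>j\<close>); and an enumeration \<open>fs\<close> of the
  faces.\<close>

definition face_matrix_choices ::
  "'b::topological_space set \<Rightarrow> ('b \<Rightarrow> 'a) \<Rightarrow> 'a simplex_map set \<Rightarrow> ('a simplex_map \<Rightarrow> 'b simplex_map) \<Rightarrow>
   ('a simplex_map \<Rightarrow> nat \<times> nat) \<Rightarrow> ('a simplex_map \<times> nat) list \<Rightarrow> 'a simplex_map list \<Rightarrow> bool" where
  "face_matrix_choices Mt p T L E rs fs \<longleftrightarrow>
     cell_lifts Mt p T L \<and>
     (\<forall>s\<in>T. fst (E s) < snd (E s) \<and> snd (E s) < 4) \<and>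
     distinct rs \<and>
     set rs = {(s, k). s \<in> T \<and> k < 4 \<and> k \<noteq> fst (E s) \<and> k \<noteq> snd (E s)} \<and>
     distinct fs \<and> set fs = cells 2 T"

text \<open>The entries are Laurent polynomials in the formal variable \<open>t\<close>, regarded as elements of
  the field of formal Laurent series, in which \<open>fls_X_intpow k\<close> is \<open>t\<close> to the power \<open>k\<close>. The
  sum is needed because two faces of a tetrahedron may be glued to each other.\<close>

definition twisted_face_matrix ::
  "(int \<Rightarrow> 'b \<Rightarrow> 'b) \<Rightarrow> ('a simplex_map \<Rightarrow> complex) \<Rightarrow> ('a simplex_map \<Rightarrow> 'b simplex_map) \<Rightarrow>
   ('a simplex_map \<times> nat) list \<Rightarrow> 'a simplex_map list \<Rightarrow> complex fls mat" where
  "twisted_face_matrix act c L rs fs =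
     mat (length rs) (length fs) (\<lambda>(a, b). case rs ! a of (s, k) \<Rightarrow>
       \<Sum>i<4. if face s i = fs ! b
              then fls_const (face_equation c s k ! i) * fls_X_intpow (twist act L s i) else 0)"

definition one_loop_polynomial ::
  "(int \<Rightarrow> 'b \<Rightarrow> 'b) \<Rightarrow> 'a simplex_map set \<Rightarrow> ('a simplex_map \<Rightarrow> complex) \<Rightarrow> ('a simplex_map \<Rightarrow> 'b simplex_map) \<Rightarrow>
   ('a simplex_map \<Rightarrow> nat \<times> nat) \<Rightarrow> ('a simplex_map \<times> nat) list \<Rightarrow> 'a simplex_map list \<Rightarrow> complex fls" where
  "one_loop_polynomial act T c L E rs fs =
     fls_const (1 / (\<Prod>e\<in>cells 1 T. c e) * (\<Prod>s\<in>T. 1 / c (edge s (fst (E s)) (snd (E s))))) *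
     Determinant.det (twisted_face_matrix act c L rs fs)"

text \<open>The order of the equations and of the faces changes the determinant by a sign, and the
  choice of lifts by a power of \<open>t\<close>; the 1-loop polynomial is an element of the Laurent
  polynomials modulo these units.\<close>

definition eq_up_to_unit :: "complex fls \<Rightarrow> complex fls \<Rightarrow> bool" (infix \<open>\<doteq>\<close> 50) where
  "P \<doteq> Q \<longleftrightarrow> (\<exists>k. P = fls_X_intpow k * Q \<or> P = - (fls_X_intpow k * Q))"


section \<open>The 2--3 Pachner move\<close>

text \<open>The bipyramid with vertices 0, 1, 2, 3, 4 which is the union of the tetrahedra
  \<open>s = [0,2,3,4]\<close> and \<open>r = [1,2,3,4]\<close>, placed so that the segment \<open>[0,1]\<close> and the
  triangle \<open>[2,3,4]\<close> have the same barycentre. A point is given by coefficients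
  \<open>x\<^sub>0, \<dots>, x\<^sub>4\<close> of a convex combination of the vertices; by
  \<open>v\<^sub>0 + v\<^sub>1 = 2/3 (v\<^sub>2 + v\<^sub>3 + v\<^sub>4)\<close> it is rewritten as one in which \<open>v\<^sub>0\<close> or \<open>v\<^sub>1\<close> does not
  occur.\<close>

definition bipyramid :: "'a simplex_map \<Rightarrow> 'a simplex_map \<Rightarrow> 'a simplex_map" where
  "bipyramid s r x =
     (let m = min (x 0) (x 1);
          y = (\<lambda>v. if v \<in> {1, 2, 3} then x (v + 1) + 2 / 3 * m else 0)
      in if x 1 \<le> x 0 then s (y(0 := x 0 - m)) else r (y(0 := x 1 - m)))"

definition pachner_2_3 :: "'a simplex_map set \<Rightarrow> 'a simplex_map set \<Rightarrow> bool" where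
  "pachner_2_3 T T' \<longleftrightarrow>
     (\<exists>s\<in>T. \<exists>r\<in>T. s \<noteq> r \<and> face s 0 = face r 0 \<and>
        T' = (T - {s, r}) \<union>
          {subsimplex (bipyramid s r) [0, 1, 2, 3],
           subsimplex (bipyramid s r) [0, 1, 3, 4],
           subsimplex (bipyramid s r) [0, 1, 2, 4]})"

end

theory Submission
  imports Defs
begin

text \<open>Changing the chosen lifts multiplies the rows and columns of the twisted face-matrix by powers
  of \<open>t\<close>, and by the Ptolemy relation the two rows of a tetrahedron for one edge are a combination
  of those for another, with determinant the ratio of the two values of \<open>c\<close>. One may therefore choose
  lifts so that the two tetrahedra of the bipyramid lift to adjacent ones, with the lifted bipyramid
  supplying the lifts of the new cells, use the edge \<open>[3,4]\<close> in the two old tetrahedra and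
  \<open>[0,1]\<close> in the three new ones. Eliminating the unknown of \<open>[2,3,4]\<close> on one side, and those of
  \<open>[0,1,2]\<close>, \<open>[0,1,3]\<close>, \<open>[0,1,4]\<close> on the other, leaves in each case three equations in the six outer
  faces of the bipyramid; they span the same space, and the base change has determinant
  \<open>c\<^sub>0\<^sub>1 / c\<^sub>3\<^sub>4\<close> up to sign.\<close>

section \<open>Row operations up to units\<close>

text \<open>The edges are chosen so that elimination is short. For \<open>[3,4]\<close>, one
  equation of each old tetrahedron does not contain the unknown of \<open>[2,3,4]\<close>, and the
  other contains it with coefficient \<open>c34\<close>; for \<open>[0,1]\<close>, each of the six
  equations contains exactly one new unknown, with coefficient \<open>c01\<close>. Thus 4 - 1 = 6 -
  3 = 3 equations remain, and the prefactors (two tetrahedra on one side, three tetrahedra and one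
  new edge on the other) reduce to 1 / \<open>c34\<close> and 1 / \<open>c01\<close>. One equation
  is common to both sides; modulo it the other two are related by a 2 x 2 matrix whose determinant
  is evaluated by the Ptolemy relation of \<open>[0,1,3,4]\<close>.

  Two obstacles shape the rest. And cells are maps, so an outer face has to be literally the same
  map before and after the move, while the new cells are told apart from the old ones by following
  interior points.\<close>

lemma eq_up_to_unit_refl [simp]: "P \<doteq> P"
  unfolding eq_up_to_unit_def by (rule exI[of _ 0]) simp

lemma eq_up_to_unit_intpow: "fls_X_intpow k * P \<doteq> P"
  unfolding eq_up_to_unit_def by blast

lemma eq_up_to_unit_uminus [simp]: "- P \<doteq> P"
  unfolding eq_up_to_unit_def by (rule exI[of _ 0]) simp

lemma eq_up_to_unit_trans [trans]:
  assumes "P \<doteq> Q" "Q \<doteq> R"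
  shows "P \<doteq> R"
proof -
  obtain j where j: "P = fls_X_intpow j * Q \<or> P = - (fls_X_intpow j * Q)"
    using assms unfolding eq_up_to_unit_def by blast
  obtain k where k: "Q = fls_X_intpow k * R \<or> Q = - (fls_X_intpow k * R)"
    using assms unfolding eq_up_to_unit_def by blast
  have "(fls_X_intpow (j + k) :: complex fls) = fls_X_intpow j * fls_X_intpow k"
    by (simp add: fls_X_intpow_times_fls_X_intpow)
  then show ?thesis
    unfolding eq_up_to_unit_def using j k by (intro exI[of _ "j + k"]) (auto simp: mult.assoc)
qed

lemma eq_up_to_unit_eq_trans [trans]:
  "P = Q \<Longrightarrow> Q \<doteq> R \<Longrightarrow> P \<doteq> R" "P \<doteq> Q \<Longrightarrow> Q = R \<Longrightarrow> P \<doteq> R"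
  by simp_all

lemma eq_up_to_unit_sym:
  assumes "P \<doteq> Q"
  shows "Q \<doteq> P"
proof -
  obtain j where j: "P = fls_X_intpow j * Q \<or> P = - (fls_X_intpow j * Q)"
    using assms unfolding eq_up_to_unit_def by blast
  have "(fls_X_intpow (- j) :: complex fls) * fls_X_intpow j = 1"
    using fls_X_intpow_times_fls_X_intpow[of "- j" j, where 'a = complex] by simp
  then have "fls_X_intpow (- j) * (fls_X_intpow j * Q) = Q"
    by (metis mult.assoc mult_1)
  then show ?thesis
    unfolding eq_up_to_unit_def using j by (intro exI[of _ "- j"]) auto
qed

lemma eq_up_to_unit_mult_left:
  assumes "P \<doteq> Q"
  shows "R * P \<doteq> R * Q"
  using assms unfolding eq_up_to_unit_def by (auto simp: mult.left_commute)

text \<open>If the numbers of rows and columns differ then \<open>row_det\<close> is 0, since \<open>Determinant.det\<close> is 0 on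
  matrices that are not square.\<close>

definition row_det :: "'f list \<Rightarrow> ('f \<Rightarrow> 'k::idom) list \<Rightarrow> 'k" where
  "row_det fs V = Determinant.det (mat (length V) (length fs) (\<lambda>(a, b). (V ! a) (fs ! b)))"

text \<open>A permutation of the rows contributes its sign, which is a unit, so any row may be
  brought to the front. For a non-square shape both sides are 0.\<close>

lemma row_det_mset_rows:
  fixes V :: "('f \<Rightarrow> complex fls) list"
  assumes "mset V = mset W"
  shows "row_det fs V \<doteq> row_det fs W"
proof (cases "length W = length fs")
  case True
  obtain p where p: "p permutes {..<length W}" "permute_list p W = V"
    using mset_eq_permutation[OF assms] by blast
  have p': "p permutes {0..<length W}"
    using p by (simp add: lessThan_atLeast0)
  define A where "A = mat (length W) (length fs) (\<lambda>(a, b). (W ! a) (fs ! b))"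
  have [simp]: "length V = length W" using assms by (rule mset_eq_length)
  have "mat (length V) (length fs) (\<lambda>(a, b). (V ! a) (fs ! b))
      = mat (length W) (length W) (\<lambda>(i, j). A $$ (p i, j))"
    using p permutes_in_image[OF p(1)] True
    by (intro eq_matI) (auto simp: A_def permute_list_nth[OF p(1)] simp flip: p(2))
  then have "row_det fs V = signof p * row_det fs W"
    unfolding row_det_def using det_permute_rows[OF _ p', of A] True by (simp add: A_def)
  then show ?thesis by (auto simp: sign_def)
qed (use mset_eq_length[OF assms] in \<open>simp add: row_det_def Determinant.det_def\<close>)

text \<open>A column is the evaluation functional of its face. With these functionals as rows and
  the old rows as columns, statements about rows carry over to columns.\<close>

lemma row_det_transpose:
  "row_det fs V = row_det V (map (\<lambda>f v. v f) fs)"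
proof (cases "length V = length fs")
  case True
  have "mat (length fs) (length V) (\<lambda>(a, b). (map (\<lambda>f v. v f) fs ! a) (V ! b))
    = transpose_mat (mat (length V) (length fs) (\<lambda>(a, b). (V ! a) (fs ! b)))"
    by (intro eq_matI) auto
  then show ?thesis
    using True by (simp add: row_det_def det_transpose[of _ "length fs"])
qed (simp add: row_det_def Determinant.det_def)

lemma row_det_mset_columns:
  fixes V :: "('f \<Rightarrow> complex fls) list"
  assumes "mset fs = mset gs"
  shows "row_det fs V \<doteq> row_det gs V"
  unfolding row_det_transpose[of _ V]
  by (rule row_det_mset_rows) (simp add: assms)

text \<open>Scaling a row, then adding a multiple of another one. The other row may stand anywhere
  in \<open>W\<close>, so no positions have to be tracked.\<close>

lemma row_det_combine:
  fixes W :: "('f \<Rightarrow> 'k::idom) list"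
  assumes b: "b \<in> set W"
  shows "row_det fs ((\<lambda>f. p * a f + q * b f) # W) = p * row_det fs (a # W)"
proof (cases "Suc (length W) = length fs")
  case True
  obtain j where j: "j < length W" "W ! j = b"
    using b by (metis in_set_conv_nth)
  let ?n = "length fs"
  define A where "A = mat ?n ?n (\<lambda>(i, k). ((a # W) ! i) (fs ! k))"
  have A: "A \<in> carrier_mat ?n ?n" by (simp add: A_def)
  have "mat ?n ?n (\<lambda>(i, k). (((\<lambda>f. p * a f + q * b f) # W) ! i) (fs ! k))
     = addrow q 0 (Suc j) (multrow 0 p A)"
    using True j by (intro eq_matI) (auto simp: A_def nth_Cons')
  also have "Determinant.det \<dots> = p * Determinant.det A"
  proof -
    have "Determinant.det (addrow q 0 (Suc j) (multrow 0 p A)) = Determinant.det (multrow 0 p A)"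
      using True j A by (intro det_addrow[of _ ?n]) auto
    also have "\<dots> = p * Determinant.det A"
      using True A by (intro det_multrow[of _ ?n]) auto
    finally show ?thesis .
  qed
  finally show ?thesis
    using True by (simp add: row_det_def A_def)
qed (simp add: row_det_def Determinant.det_def)

text \<open>Elimination of the unknown \<open>g\<close> by the pivot row \<open>a\<close>: the
  matrix is block triangular with a 1 x 1 corner.\<close>

lemma row_det_expand:
  fixes W :: "('f \<Rightarrow> 'k::idom) list"
  assumes "\<And>w. w \<in> set W \<Longrightarrow> w g = 0"
  shows "row_det (g # fs) (a # W) = a g * row_det fs W"
proof (cases "length W = length fs")
  case True
  let ?n = "length fs"
  have W: "(W ! i) g = 0" if "i < ?n" for i
    using assms True that by auto
  have "mat (Suc ?n) (Suc ?n) (\<lambda>(i, k). ((a # W) ! i) ((g # fs) ! k))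
     = four_block_mat (mat 1 1 (\<lambda>_. a g)) (mat 1 ?n (\<lambda>(_, k). a (fs ! k)))
         (0\<^sub>m ?n 1) (mat ?n ?n (\<lambda>(i, k). (W ! i) (fs ! k)))"
    using True W by (intro eq_matI) (auto simp: four_block_mat_def nth_Cons')
  also have "Determinant.det \<dots>
     = Determinant.det (mat 1 1 (\<lambda>_. a g)) * Determinant.det (mat ?n ?n (\<lambda>(i, k). (W ! i) (fs ! k)))"
    by (rule det_four_block_mat_lower_left_zero_col) auto
  also have "Determinant.det (mat 1 1 (\<lambda>_. a g)) = a g"
    by (simp add: det_single)
  finally show ?thesis
    using True by (simp add: row_det_def)
qed (simp add: row_det_def Determinant.det_def)

text \<open>Every term of the Leibniz formula takes one entry from each row and each column, so it
  collects all factors \<open>x\<close> and, after reindexing by the permutation, all factors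
  \<open>y\<close>.\<close>

lemma row_det_scale:
  fixes V :: "'r \<Rightarrow> 'f \<Rightarrow> 'k::idom"
  shows "row_det fs (map (\<lambda>r f. x r * V r f * y f) rs)
    = prod_list (map x rs) * prod_list (map y fs) * row_det fs (map V rs)"
proof (cases "length rs = length fs")
  case True
  let ?n = "length fs"
  have xs: "prod_list (map x rs) = (\<Prod>i=0..<?n. x (rs ! i))"
    using True by (simp add: prod.list_conv_set_nth)
  have ys: "prod_list (map y fs) = (\<Prod>i=0..<?n. y (fs ! i))"
    by (simp add: prod.list_conv_set_nth)
  have p: "(\<Prod>i=0..<?n. x (rs ! i) * V (rs ! i) (fs ! \<pi> i) * y (fs ! \<pi> i))
    = prod_list (map x rs) * prod_list (map y fs) * (\<Prod>i=0..<?n. V (rs ! i) (fs ! \<pi> i))"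
    if "\<pi> permutes {0..<?n}" for \<pi>
    unfolding xs ys prod.permute[OF that, of "\<lambda>i. y (fs ! i)"]
    by (simp add: prod.distrib ac_simps)
  have "row_det fs (map (\<lambda>r f. x r * V r f * y f) rs) = (\<Sum>\<pi> | \<pi> permutes {0..<?n}.
      signof \<pi> * (\<Prod>i=0..<?n. x (rs ! i) * V (rs ! i) (fs ! \<pi> i) * y (fs ! \<pi> i)))"
    using True unfolding row_det_def Determinant.det_def
    by (auto intro!: sum.cong prod.cong simp: permutes_in_image)
  also have "\<dots> = (\<Sum>\<pi> | \<pi> permutes {0..<?n}. prod_list (map x rs) * prod_list (map y fs) *
      (signof \<pi> * (\<Prod>i=0..<?n. V (rs ! i) (fs ! \<pi> i))))"
    by (intro sum.cong refl) (auto simp: p)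
  also have "\<dots> = prod_list (map x rs) * prod_list (map y fs) * row_det fs (map V rs)"
    using True unfolding row_det_def Determinant.det_def sum_distrib_left [symmetric]
    by (auto intro!: sum.cong prod.cong simp: permutes_in_image)
  finally show ?thesis .
qed (simp add: row_det_def Determinant.det_def)

text \<open>The effect of new lifts: \<open>x\<close> is the shift of the tetrahedron that owns the
  row, \<open>y\<close> that of the face that indexes the column.\<close>

lemma row_det_scale_intpow:
  fixes V :: "'r \<Rightarrow> 'f \<Rightarrow> complex fls"
  shows "row_det fs (map (\<lambda>r f. fls_X_intpow (x r) * V r f * fls_X_intpow (y f)) rs)
    \<doteq> row_det fs (map V rs)"
proof -
  have X: "prod_list (map (\<lambda>u. fls_X_intpow (z u)) us) = (fls_X_intpow (sum_list (map z us)) :: complex fls)"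
    for z and us :: "'u list"
    by (induction us) (simp_all add: fls_X_intpow_times_fls_X_intpow)
  show ?thesis
    unfolding row_det_scale X fls_X_intpow_times_fls_X_intpow
    by (rule eq_up_to_unit_intpow)
qed

section \<open>The rows of a tetrahedron\<close>

text \<open>The exponents of \<open>t\<close> are a parameter \<open>\<tau>\<close>, so that
  different systems of lifts can be compared.\<close>

definition face_row ::
  "('a simplex_map \<Rightarrow> complex) \<Rightarrow> ('a simplex_map \<Rightarrow> nat \<Rightarrow> int) \<Rightarrow> 'a simplex_map \<Rightarrow> nat \<Rightarrow>
   'a simplex_map \<Rightarrow> complex fls" where
  "face_row c \<tau> s k g =
     (\<Sum>i<4. fls_const (face_equation c s k ! i) * (if face s i = g then fls_X_intpow (\<tau> s i) else 0))"

definition edge_rows ::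
  "('a simplex_map \<Rightarrow> complex) \<Rightarrow> ('a simplex_map \<Rightarrow> nat \<Rightarrow> int) \<Rightarrow> nat \<times> nat \<Rightarrow> 'a simplex_map \<Rightarrow>
   ('a simplex_map \<Rightarrow> complex fls) list" where
  "edge_rows c \<tau> e s = map (face_row c \<tau> s) (filter (\<lambda>k. k \<noteq> fst e \<and> k \<noteq> snd e) [0, 1, 2, 3])"

lemma edge_rows_0_1: "edge_rows c \<tau> (0, 1) t = [face_row c \<tau> t 2, face_row c \<tau> t 3]"
  by (simp add: edge_rows_def)

text \<open>A relation between untwisted equations survives twisting, because the power of
  \<open>t\<close> attached to an unknown is the same in all four equations of
  \<open>s\<close>.\<close>

lemma face_row_combine:
  assumes "\<And>i. i < 4 \<Longrightarrow>
    face_equation c s k ! i = x * face_equation c s l ! i + y * face_equation c s m ! i"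
  shows "face_row c \<tau> s k = (\<lambda>g. fls_const x * face_row c \<tau> s l g + fls_const y * face_row c \<tau> s m g)"
proof
  fix g
  let ?u = "\<lambda>i. if face s i = g then fls_X_intpow (\<tau> s i) else 0 :: complex fls"
  have "face_row c \<tau> s k g = (\<Sum>i<4. fls_const x * (fls_const (face_equation c s l ! i) * ?u i)
      + fls_const y * (fls_const (face_equation c s m ! i) * ?u i))"
    unfolding face_row_def
    by (intro sum.cong) (simp_all add: assms distrib_right mult.assoc
      flip: fls_plus_const fls_const_mult_const del: fls_const_mult_const)
  then show "face_row c \<tau> s k g = fls_const x * face_row c \<tau> s l g + fls_const y * face_row c \<tau> s m g"
    by (simp add: face_row_def sum.distrib sum_distrib_left)
qed

lemma row_det_swap:
  fixes W :: "('f \<Rightarrow> complex fls) list"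
  shows "row_det fs (a # b # W) \<doteq> row_det fs (b # a # W)"
  by (rule row_det_mset_rows) simp

lemma row_det_replace_first:
  assumes "\<And>i. i < 4 \<Longrightarrow>
    face_equation c s k ! i = x * face_equation c s l ! i + y * face_equation c s m ! i"
  shows "row_det fs (face_row c \<tau> s k # face_row c \<tau> s m # W)
    = fls_const x * row_det fs (face_row c \<tau> s l # face_row c \<tau> s m # W)"
proof -
  have "face_row c \<tau> s k = (\<lambda>g. fls_const x * face_row c \<tau> s l g + fls_const y * face_row c \<tau> s m g)"
    by (rule face_row_combine) (rule assms)
  then show ?thesis by (simp only:) (rule row_det_combine, simp)
qed

lemma less_4_iff: "i < 4 \<longleftrightarrow> i = 0 \<or> i = 1 \<or> i = 2 \<or> i = (3::nat)"
  by auto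

text \<open>After a change of sign in equations 1 and 3, the coefficients form a skew-symmetric 4 x
  4 matrix whose Pfaffian is the Ptolemy relation. It therefore has rank 2, and any two of its rows
  span the same plane. Every pair is compared with the rows 2 and 3, which belong to the edge
  \<open>[0,1]\<close>.\<close>

lemma edge_rows_change:
  assumes nz: "\<And>i j. i < j \<Longrightarrow> j < 4 \<Longrightarrow> c (edge s i j) \<noteq> 0"
    and pt: "c (edge s 0 1) * c (edge s 2 3) - c (edge s 0 2) * c (edge s 1 3)
        + c (edge s 0 3) * c (edge s 1 2) = 0"
    and e: "fst e < snd e" "snd e < 4"
  shows "fls_const (1 / c (edge s (fst e) (snd e))) * row_det fs (edge_rows c \<tau> e s @ W)
    \<doteq> fls_const (1 / c (edge s 0 1)) * row_det fs (edge_rows c \<tau> (0, 1) s @ W)"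
proof -
  let ?R = "face_row c \<tau> s"
  define c01 where "c01 = c (edge s 0 1)"
  define c02 where "c02 = c (edge s 0 2)"
  define c03 where "c03 = c (edge s 0 3)"
  define c12 where "c12 = c (edge s 1 2)"
  define c13 where "c13 = c (edge s 1 3)"
  define c23 where "c23 = c (edge s 2 3)"
  note d = c01_def c02_def c03_def c12_def c13_def c23_def
  have z: "c01 \<noteq> 0" "c02 \<noteq> 0" "c03 \<noteq> 0" "c12 \<noteq> 0" "c13 \<noteq> 0" "c23 \<noteq> 0"
    unfolding d by (simp_all add: nz)
  have pt': "c01 * c23 = c02 * c13 - c03 * c12"
    using pt unfolding d by (simp add: algebra_simps)
  have eq: "face_equation c s 0 = [0, c23, - c13, c12]" "face_equation c s 1 = [c23, 0, - c03, c02]"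
    "face_equation c s 2 = [c13, - c03, 0, c01]" "face_equation c s 3 = [c12, - c02, c01, 0]"
    by (simp_all add: face_equation_def d)
  let ?D = "\<lambda>k l. row_det fs (?R k # ?R l # W)"
  let ?B = "fls_const (1 / c01) * ?D 2 3"
  have D13: "?D 1 3 = fls_const (c02 / c01) * ?D 2 3"
    by (rule row_det_replace_first[where y = "- c03 / c01"])
       (use z pt' in \<open>auto simp: less_4_iff eq field_simps simp del: One_nat_def\<close>)
  have D03: "?D 0 3 = fls_const (c12 / c01) * ?D 2 3"
    by (rule row_det_replace_first[where y = "- c13 / c01"])
       (use z pt' in \<open>auto simp: less_4_iff eq field_simps simp del: One_nat_def\<close>)
  have D12: "?D 1 2 = fls_const (- c03 / c01) * ?D 3 2"
    by (rule row_det_replace_first[where y = "c02 / c01"])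
       (use z pt' in \<open>auto simp: less_4_iff eq field_simps simp del: One_nat_def\<close>)
  have D02: "?D 0 2 = fls_const (- c13 / c01) * ?D 3 2"
    by (rule row_det_replace_first[where y = "c12 / c01"])
       (use z pt' in \<open>auto simp: less_4_iff eq field_simps simp del: One_nat_def\<close>)
  \<comment> \<open>The pair 0, 1 has no row in common with 2, 3, so it is reached in two exchanges,
    by way of the pair 1, 3.\<close>
  have D01: "?D 0 1 = fls_const (- c23 / c02) * ?D 3 1"
    by (rule row_det_replace_first[where y = "c12 / c02"])
       (use z pt' in \<open>auto simp: less_4_iff eq field_simps simp del: One_nat_def\<close>)
  have c3: "fls_const x * (fls_const y * P) = fls_const (x * y) * P" for x y and P :: "complex fls"
    by (simp flip: mult.assoc)
  have neg: "fls_const (- x) * P \<doteq> fls_const x * P" for x and P :: "complex fls"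
    by (metis eq_up_to_unit_uminus fls_const_uminus minus_mult_left)
  have sw: "fls_const (- x) * ?D k l \<doteq> fls_const x * ?D l k" for x k l
    using neg eq_up_to_unit_mult_left[OF row_det_swap] by (rule eq_up_to_unit_trans)
  have "fls_const (1 / c02) * ?D 1 3 = ?B" "fls_const (1 / c12) * ?D 0 3 = ?B"
    unfolding D13 D03 c3 using z by simp_all
  moreover have "fls_const (1 / c03) * ?D 1 2 \<doteq> ?B" "fls_const (1 / c13) * ?D 0 2 \<doteq> ?B"
    using sw[of "1 / c01" 3 2] unfolding D12 D02 c3 using z by simp_all
  moreover have "fls_const (1 / c23) * ?D 0 1 \<doteq> ?B"
  proof -
    have "fls_const (1 / c23) * ?D 0 1 = fls_const (- (1 / c02)) * ?D 3 1"
      unfolding D01 c3 using z by simp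
    also have "\<dots> \<doteq> fls_const (1 / c02) * ?D 1 3" by (rule sw)
    also have "\<dots> = ?B" by fact
    finally show ?thesis .
  qed
  moreover have "e \<in> {(0, 1), (0, 2), (0, 3), (1, 2), (1, 3), (2, 3)}"
    using e by (cases e) (auto simp: less_4_iff simp del: One_nat_def)
  ultimately show ?thesis
    by (auto simp: edge_rows_def simp flip: d simp del: One_nat_def)
qed

text \<open>The tetrahedra are treated one after the other; \<open>U\<close> collects the rows
  already replaced, which keeps the determinant at full size during the induction.\<close>

lemma concat_edge_rows_change:
  assumes nz: "\<And>s i j. s \<in> set ss \<Longrightarrow> i < j \<Longrightarrow> j < 4 \<Longrightarrow> c (edge s i j) \<noteq> 0"
    and pt: "\<And>s. s \<in> set ss \<Longrightarrow> c (edge s 0 1) * c (edge s 2 3) - c (edge s 0 2) * c (edge s 1 3)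
        + c (edge s 0 3) * c (edge s 1 2) = 0"
    and E: "\<And>s. s \<in> set ss \<Longrightarrow> fst (E s) < snd (E s) \<and> snd (E s) < 4"
  shows "fls_const (\<Prod>s\<leftarrow>ss. 1 / c (edge s (fst (E s)) (snd (E s))))
      * row_det fs (U @ concat (map (\<lambda>s. edge_rows c \<tau> (E s) s) ss))
    \<doteq> fls_const (\<Prod>s\<leftarrow>ss. 1 / c (edge s 0 1))
      * row_det fs (U @ concat (map (\<lambda>s. edge_rows c \<tau> (0, 1) s) ss))"
  using assms
proof (induction ss arbitrary: U)
  case (Cons s ss)
  let ?e = "1 / c (edge s (fst (E s)) (snd (E s)))" and ?z = "1 / c (edge s 0 1)"
  let ?p = "\<Prod>s\<leftarrow>ss. 1 / c (edge s (fst (E s)) (snd (E s)))" and ?q = "\<Prod>s\<leftarrow>ss. 1 / c (edge s 0 1)"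
  let ?W = "concat (map (\<lambda>s. edge_rows c \<tau> (E s) s) ss)"
  let ?Z = "concat (map (\<lambda>s. edge_rows c \<tau> (0, 1) s) ss)"
  have "fls_const (?e * ?p) * row_det fs (U @ edge_rows c \<tau> (E s) s @ ?W)
     \<doteq> fls_const (?e * ?p) * row_det fs (edge_rows c \<tau> (E s) s @ U @ ?W)"
    by (intro eq_up_to_unit_mult_left row_det_mset_rows) simp
  also have "\<dots> = fls_const ?p * (fls_const ?e * row_det fs (edge_rows c \<tau> (E s) s @ U @ ?W))"
    by (simp add: mult.commute flip: mult.assoc)
  also have "\<dots> \<doteq> fls_const ?p * (fls_const ?z * row_det fs (edge_rows c \<tau> (0, 1) s @ U @ ?W))"
    by (intro eq_up_to_unit_mult_left edge_rows_change) (use Cons.prems in auto)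
  also have "\<dots> \<doteq> fls_const ?p * (fls_const ?z * row_det fs ((U @ edge_rows c \<tau> (0, 1) s) @ ?W))"
    by (intro eq_up_to_unit_mult_left row_det_mset_rows) simp
  also have "\<dots> = fls_const ?z * (fls_const ?p * row_det fs ((U @ edge_rows c \<tau> (0, 1) s) @ ?W))"
    by (simp add: mult.left_commute)
  also have "\<dots> \<doteq> fls_const ?z * (fls_const ?q * row_det fs ((U @ edge_rows c \<tau> (0, 1) s) @ ?Z))"
    by (intro eq_up_to_unit_mult_left Cons.IH) (use Cons.prems in auto)
  also have "\<dots> = fls_const (?z * ?q) * row_det fs (U @ edge_rows c \<tau> (0, 1) s @ ?Z)"
    by (simp flip: mult.assoc)
  finally show ?case by simp
qed simp

section \<open>The determinant identity behind the 2--3 move\<close>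

lemma row_det_two_rows:
  fixes W :: "('f \<Rightarrow> complex fls) list"
  assumes "p \<noteq> 0"
  shows "row_det fs ((\<lambda>f. p * a f + q * b f) # (\<lambda>f. r * a f + t * b f) # W)
    \<doteq> (p * t - q * r) * row_det fs (a # b # W)"
proof -
  let ?a = "\<lambda>f. p * a f + q * b f" and ?b = "\<lambda>f. r * a f + t * b f"
  \<comment> \<open>\<open>p\<close> is the pivot: solving the new first row for \<open>a\<close>
    turns the second one into a multiple of \<open>b\<close> plus a multiple of the first.\<close>
  have b: "?b = (\<lambda>f. (t - r / p * q) * b f + r / p * ?a f)"
    using assms by (auto simp: field_simps)
  have "row_det fs (?a # ?b # W) \<doteq> row_det fs (?b # ?a # W)"
    by (rule row_det_swap)
  also have "\<dots> = (t - r / p * q) * row_det fs (b # ?a # W)"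
    by (subst b, rule row_det_combine) simp
  also have "\<dots> \<doteq> (t - r / p * q) * row_det fs (?a # b # W)"
    by (intro eq_up_to_unit_mult_left row_det_swap)
  also have "row_det fs (?a # b # W) = p * row_det fs (a # b # W)"
    by (rule row_det_combine) simp
  also have "(t - r / p * q) * (p * row_det fs (a # b # W)) = (p * t - q * r) * row_det fs (a # b # W)"
    using assms by (simp add: field_simps)
  finally show ?thesis .
qed

lemma row_det_subtract:
  fixes W :: "('f \<Rightarrow> complex fls) list"
  assumes "b \<in> set W"
  shows "row_det fs ((\<lambda>f. a f - b f) # W) = row_det fs (a # W)"
  using row_det_combine[OF assms, of fs 1 a "- 1"] by simp

text \<open>\<open>w\<^sub>i\<^sub>j\<^sub>k\<close> stands for the unknown of the face \<open>[i,j,k]\<close>, \<open>u\<^sub>v\<close> for that of \<open>[0,1,v]\<close>,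
  \<open>f\<close> for the column of \<open>[2,3,4]\<close> and \<open>n\<^sub>v\<close> for the column of \<open>[0,1,v]\<close>.\<close>

lemma pachner_row_det:
  fixes w023 w024 w034 w123 w124 w134 w234 u2 u3 u4 :: "'f \<Rightarrow> complex fls"
    and c01 c02 c03 c04 c12 c13 c14 c23 c24 c34 :: "complex fls"
  assumes nz: "c01 \<noteq> 0" "c04 \<noteq> 0" "c34 \<noteq> 0"
    and pt0: "c02 * c34 - c03 * c24 + c04 * c23 = 0"
    and pt1: "c12 * c34 - c13 * c24 + c14 * c23 = 0"
    and pt2: "c01 * c34 - c03 * c14 + c04 * c13 = 0"
    and w: "\<And>v n. v \<in> {w023, w024, w034, w123, w124, w134} \<union> set W \<Longrightarrow> n \<in> {f, n2, n3, n4} \<Longrightarrow> v n = 0"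
    and f: "w234 f = 1"
    and u: "u2 n2 = 1" "u2 n3 = 0" "u2 n4 = 0" "u3 n2 = 0" "u3 n3 = 1" "u3 n4 = 0"
      "u4 n2 = 0" "u4 n3 = 0" "u4 n4 = 1"
  shows "1 / c34\<^sup>2 * row_det (f # G)
     ([\<lambda>g. c34 * w034 g - c24 * w024 g + c23 * w023 g, \<lambda>g. c34 * w234 g - c04 * w024 g + c03 * w023 g,
       \<lambda>g. c34 * w134 g - c24 * w124 g + c23 * w123 g, \<lambda>g. c34 * w234 g - c14 * w124 g + c13 * w123 g] @ W)
    \<doteq> 1 / c01 ^ 4 * row_det ([n2, n3, n4] @ G)
     ([\<lambda>g. c13 * w123 g - c03 * w023 g + c01 * u2 g, \<lambda>g. c12 * w123 g - c02 * w023 g + c01 * u3 g,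
       \<lambda>g. c14 * w134 g - c04 * w034 g + c01 * u3 g, \<lambda>g. c13 * w134 g - c03 * w034 g + c01 * u4 g,
       \<lambda>g. c14 * w124 g - c04 * w024 g + c01 * u2 g, \<lambda>g. c12 * w124 g - c02 * w024 g + c01 * u4 g] @ W)"
proof -
  define s0 where "s0 = (\<lambda>g. c34 * w034 g - c24 * w024 g + c23 * w023 g)"
  define s1 where "s1 = (\<lambda>g. c34 * w234 g - c04 * w024 g + c03 * w023 g)"
  define r0 where "r0 = (\<lambda>g. c34 * w134 g - c24 * w124 g + c23 * w123 g)"
  define r1 where "r1 = (\<lambda>g. c34 * w234 g - c14 * w124 g + c13 * w123 g)"
  define A2 where "A2 = (\<lambda>g. c13 * w123 g - c03 * w023 g + c01 * u2 g)"
  define A3 where "A3 = (\<lambda>g. c12 * w123 g - c02 * w023 g + c01 * u3 g)"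
  define C2 where "C2 = (\<lambda>g. c14 * w134 g - c04 * w034 g + c01 * u3 g)"
  define C3 where "C3 = (\<lambda>g. c13 * w134 g - c03 * w034 g + c01 * u4 g)"
  define D2 where "D2 = (\<lambda>g. c14 * w124 g - c04 * w024 g + c01 * u2 g)"
  define D3 where "D3 = (\<lambda>g. c12 * w124 g - c02 * w024 g + c01 * u4 g)"
  define X2 where "X2 = (\<lambda>g. A2 g - D2 g)"
  define X3 where "X3 = (\<lambda>g. A3 g - C2 g)"
  define X4 where "X4 = (\<lambda>g. C3 g - D3 g)"
  note rows = s0_def s1_def r0_def r1_def A2_def A3_def C2_def C3_def D2_def D3_def X2_def X3_def X4_def
  let ?N = "[n2, n3, n4] @ G"
  have w': "w023 n = 0" "w024 n = 0" "w034 n = 0" "w123 n = 0" "w124 n = 0" "w134 n = 0"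
    if "n \<in> {f, n2, n3, n4}" for n
    using w that by blast+
  have W: "v n = 0" if "v \<in> set W" "n \<in> {f, n2, n3, n4}" for v n
    using w that by blast
  note vals = w' W u f rows

  have "row_det (f # G) ([s0, s1, r0, r1] @ W) \<doteq> row_det (f # G) (s1 # [r1, s0, r0] @ W)"
    by (rule row_det_mset_rows) simp
  \<comment> \<open>The unknown of \<open>[2,3,4]\<close> occurs only in \<open>s1\<close> and
    \<open>r1\<close>, with the same coefficient \<open>c34\<close>, so their difference is free of
    it. This difference is \<open>- X2\<close>, the one equation that both sides share.\<close>
  also have "\<dots> = row_det (f # G) ((\<lambda>g. s1 g - r1 g) # [r1, s0, r0] @ W)"
    by (rule row_det_subtract [symmetric]) simp
  also have "(\<lambda>g. s1 g - r1 g) = (\<lambda>g. - 1 * X2 g + 0 * s0 g)"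
    by (auto simp: rows algebra_simps)
  also have "row_det (f # G) (\<dots> # [r1, s0, r0] @ W) = - 1 * row_det (f # G) (X2 # [r1, s0, r0] @ W)"
    by (rule row_det_combine) simp
  also have "\<dots> \<doteq> row_det (f # G) (X2 # [r1, s0, r0] @ W)"
    by simp
  also have "\<dots> \<doteq> row_det (f # G) (r1 # [X2, s0, r0] @ W)"
    by (rule row_det_mset_rows) simp
  also have "\<dots> = r1 f * row_det G ([X2, s0, r0] @ W)"
    by (subst row_det_expand) (auto simp: vals)
  also have "\<dots> = c34 * row_det G ([X2, s0, r0] @ W)"
    by (simp add: vals)
  finally have left: "row_det (f # G) ([s0, s1, r0, r1] @ W) \<doteq> c34 * row_det G ([X2, s0, r0] @ W)" .

  \<comment> \<open>The rows \<open>A2\<close>, \<open>D2\<close> share \<open>u2\<close>, the rows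
    \<open>A3\<close>, \<open>C2\<close> share \<open>u3\<close>, and \<open>C3\<close>,
    \<open>D3\<close> share \<open>u4\<close>. In each pair one row is replaced by the difference,
    and the other stays as a pivot with entry \<open>c01\<close>.\<close>
  have "row_det ?N ([A2, A3, C2, C3, D2, D3] @ W) \<doteq> row_det ?N (A2 # [D2, A3, C2, C3, D3] @ W)"
    by (rule row_det_mset_rows) simp
  also have "\<dots> = row_det ?N (X2 # [D2, A3, C2, C3, D3] @ W)"
    unfolding X2_def by (rule row_det_subtract [symmetric]) simp
  also have "\<dots> \<doteq> row_det ?N (A3 # [X2, D2, C2, C3, D3] @ W)"
    by (rule row_det_mset_rows) simp
  also have "\<dots> = row_det ?N (X3 # [X2, D2, C2, C3, D3] @ W)"
    unfolding X3_def by (rule row_det_subtract [symmetric]) simp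
  also have "\<dots> \<doteq> row_det ?N (C3 # [X3, X2, D2, C2, D3] @ W)"
    by (rule row_det_mset_rows) simp
  also have "\<dots> = row_det ?N (X4 # [X3, X2, D2, C2, D3] @ W)"
    unfolding X4_def by (rule row_det_subtract [symmetric]) simp
  also have "\<dots> \<doteq> row_det ?N (D2 # C2 # D3 # X3 # [X4, X2] @ W)"
    by (rule row_det_mset_rows) simp
  also have "\<dots> = D2 n2 * (C2 n3 * (D3 n4 * row_det G (X3 # [X4, X2] @ W)))"
    by (subst append_Cons, subst row_det_expand; (subst append_Cons, subst row_det_expand)?; (subst append_Cons, subst row_det_expand)?) (auto simp: vals)
  also have "\<dots> = c01 ^ 3 * row_det G (X3 # [X4, X2] @ W)"
    by (simp add: vals power3_eq_cube)
  finally have "row_det ?N ([A2, A3, C2, C3, D2, D3] @ W) \<doteq> c01 ^ 3 * row_det G (X3 # [X4, X2] @ W)" .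
  moreover have "row_det G (X3 # [X4, X2] @ W) \<doteq> - (c01 / c34 * row_det G ([X2, s0, r0] @ W))"
  proof -
    \<comment> \<open>\<open>?P\<close> and \<open>?Q\<close> represent \<open>X3\<close> and
      \<open>X4\<close> modulo \<open>X2\<close>. Their coefficients are forced by the unknowns of
      \<open>[0,3,4]\<close> and \<open>[1,3,4]\<close>, each of which occurs in just one of
      \<open>s0\<close> and \<open>r0\<close>, with coefficient \<open>c34\<close>, and not in
      \<open>X2\<close>.\<close>
    let ?P = "\<lambda>g. c04 / c34 * s0 g + - c14 / c34 * r0 g" and ?Q = "\<lambda>g. - c03 / c34 * s0 g + c13 / c34 * r0 g"
    have X3: "X3 = (\<lambda>g. 1 * ?P g + c24 / c34 * X2 g)"
    proof
      fix g
      \<comment> \<open>With the coefficients of \<open>s0\<close>, \<open>r0\<close> and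
        \<open>X2\<close> fixed, the unknowns of \<open>[0,2,3]\<close> and \<open>[1,2,3]\<close>
        match up to multiples of the Ptolemy relations of the two old tetrahedra.\<close>
      have "c34 * X3 g = c04 * s0 g - c14 * r0 g + c24 * X2 g
         - (c02 * c34 - c03 * c24 + c04 * c23) * w023 g + (c12 * c34 - c13 * c24 + c14 * c23) * w123 g"
        unfolding rows by (simp add: algebra_simps)
      then have "X3 g = (c04 * s0 g - c14 * r0 g + c24 * X2 g) / c34"
        unfolding pt0 pt1 using nz by (simp add: nonzero_eq_divide_eq mult.commute)
      then show "X3 g = 1 * ?P g + c24 / c34 * X2 g"
        by (simp add: add_divide_distrib diff_divide_distrib)
    qed
    have X4: "X4 = (\<lambda>g. 1 * ?Q g + - c23 / c34 * X2 g)"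
    proof
      fix g
      have "c34 * X4 g = c13 * r0 g - c03 * s0 g - c23 * X2 g
         + (c02 * c34 - c03 * c24 + c04 * c23) * w024 g - (c12 * c34 - c13 * c24 + c14 * c23) * w124 g"
        unfolding rows by (simp add: algebra_simps)
      then have "X4 g = (c13 * r0 g - c03 * s0 g - c23 * X2 g) / c34"
        unfolding pt0 pt1 using nz by (simp add: nonzero_eq_divide_eq mult.commute)
      then show "X4 g = 1 * ?Q g + - c23 / c34 * X2 g"
        by (simp add: add_divide_distrib diff_divide_distrib)
    qed
    have "row_det G (X3 # [X4, X2] @ W) = 1 * row_det G (?P # [X4, X2] @ W)"
      unfolding X3 by (rule row_det_combine) simp
    also have "\<dots> \<doteq> row_det G (X4 # ?P # [X2] @ W)"
      by (simp add: row_det_swap)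
    also have "\<dots> = 1 * row_det G (?Q # ?P # [X2] @ W)"
      by (subst X4, rule row_det_combine) simp
    also have "\<dots> \<doteq> row_det G (?P # ?Q # [X2] @ W)"
      by (simp add: row_det_swap)
    also have "\<dots> \<doteq> (c04 / c34 * (c13 / c34) - - c14 / c34 * (- c03 / c34)) * row_det G (s0 # r0 # [X2] @ W)"
      using nz by (intro row_det_two_rows) simp
    \<comment> \<open>The Ptolemy relation of the new tetrahedron \<open>[0,1,3,4]\<close> enters
      here; it is the source of the factor \<open>c01\<close> in the base change.\<close>
    also have "c04 / c34 * (c13 / c34) - - c14 / c34 * (- c03 / c34) = - (c01 / c34)"
    proof -
      have "c04 * c13 - c14 * c03 = (c01 * c34 - c03 * c14 + c04 * c13) - c01 * c34"
        by (simp add: algebra_simps)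
      then have "c04 * c13 - c14 * c03 = - (c01 * c34)"
        unfolding pt2 by simp
      moreover have "c04 / c34 * (c13 / c34) - - c14 / c34 * (- c03 / c34) = (c04 * c13 - c14 * c03) / (c34 * c34)"
        by (simp add: diff_divide_distrib)
      ultimately show ?thesis
        using nz by simp
    qed
    also have "- (c01 / c34) * row_det G (s0 # r0 # [X2] @ W) \<doteq> - (c01 / c34) * row_det G ([X2, s0, r0] @ W)"
      by (intro eq_up_to_unit_mult_left row_det_mset_rows) simp
    finally show ?thesis by simp
  qed
  ultimately have "row_det ?N ([A2, A3, C2, C3, D2, D3] @ W)
      \<doteq> c01 ^ 3 * - (c01 / c34 * row_det G ([X2, s0, r0] @ W))"
    by (blast intro: eq_up_to_unit_trans eq_up_to_unit_mult_left)
  then have "1 / c01 ^ 4 * row_det ?N ([A2, A3, C2, C3, D2, D3] @ W)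
      \<doteq> 1 / c01 ^ 4 * (c01 ^ 3 * - (c01 / c34 * row_det G ([X2, s0, r0] @ W)))"
    by (rule eq_up_to_unit_mult_left)
  \<comment> \<open>The four powers of \<open>c01\<close> cancel: three come from the pivots, one
    from the base change.\<close>
  also have "\<dots> = - (1 / c34\<^sup>2 * (c34 * row_det G ([X2, s0, r0] @ W)))"
    using nz by (simp add: field_simps eval_nat_numeral)
  also have "\<dots> \<doteq> 1 / c34\<^sup>2 * (c34 * row_det G ([X2, s0, r0] @ W))"
    by simp
  also have "\<dots> \<doteq> 1 / c34\<^sup>2 * row_det (f # G) ([s0, s1, r0, r1] @ W)"
    by (intro eq_up_to_unit_mult_left eq_up_to_unit_sym[OF left])
  finally show ?thesis
    unfolding rows(1-10) by (rule eq_up_to_unit_sym)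
qed

section \<open>Lifts of ideal simplices\<close>

text \<open>\<open>covering_space_lift_unique\<close> of the library requires the cover to lie in a normed space.\<close>

lemma covering_lift_unique:
  assumes cov: "covering_space Mt p M" and S: "connected S"
    and g: "continuous_on S g" "g ` S \<subseteq> Mt" and h: "continuous_on S h" "h ` S \<subseteq> Mt"
    and eq: "\<And>x. x \<in> S \<Longrightarrow> p (g x) = p (h x)"
    and a: "a \<in> S" "g a = h a" and x: "x \<in> S"
  shows "g x = h x"
proof -
  \<comment> \<open>The set where \<open>g\<close> and \<open>h\<close> agree is open and has an
    open complement. \<open>R\<close> expresses both at once, as an equivalence relation with open
    classes on the connected set \<open>S\<close>.\<close>
  define R where "R = (\<lambda>x y. (g x = h x) = (g y = h y))"
  have "R a x"
  proof (rule connected_equivalence_relation[OF S a(1) x])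
    show "R z y" if "R y z" for y z using that by (auto simp: R_def)
    show "R y w" if "R y z" "R z w" for y z w using that by (auto simp: R_def)
    fix b assume b: "b \<in> S"
    have "p (g b) \<in> M"
      using covering_space_imp_surjective[OF cov] g(2) b by blast
    have "\<forall>x\<in>M. \<exists>T. x \<in> T \<and> openin (top_of_set M) T \<and> (\<exists>v. \<Union>v = Mt \<inter> p -` T \<and>
        (\<forall>u\<in>v. openin (top_of_set Mt) u) \<and> pairwise disjnt v \<and> (\<forall>u\<in>v. \<exists>q. homeomorphism u T p q))"
      using cov by (simp add: covering_space_def)
    from bspec[OF this \<open>p (g b) \<in> M\<close>] obtain T v where v: "p (g b) \<in> T" "\<Union>v = Mt \<inter> p -` T"
        "\<forall>u\<in>v. openin (top_of_set Mt) u" "pairwise disjnt v" "\<forall>u\<in>v. \<exists>q. homeomorphism u T p q"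
      by (elim exE conjE) (rule that)
    have "g b \<in> Mt \<inter> p -` T" "h b \<in> Mt \<inter> p -` T"
      using v(1) g(2) h(2) b eq[OF b] by auto
    then obtain V W where V: "V \<in> v" "g b \<in> V" and W: "W \<in> v" "h b \<in> W"
      unfolding v(2)[symmetric] by blast
    \<comment> \<open>On \<open>?U\<close> the maps stay in their sheets \<open>V\<close> and
      \<open>W\<close>. If the sheets coincide, injectivity of \<open>p\<close> decides agreement at
      all points alike; otherwise they are disjoint and the maps differ throughout.\<close>
    let ?U = "(S \<inter> g -` V) \<inter> (S \<inter> h -` W)"
    have "openin (top_of_set S) ?U"
      using g h bspec[OF v(3) V(1)] bspec[OF v(3) W(1)]
      by (intro openin_Int continuous_openin_preimage[where T = Mt]) (simp_all add: image_subset_iff_funcset)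
    moreover have "R b y" if y: "y \<in> ?U" for y
    proof (cases "V = W")
      case True
      obtain q where "homeomorphism V T p q"
        using bspec[OF v(5) V(1)] ..
      then have "inj_on p V"
        by (intro inj_on_inverseI[of V q]) (rule homeomorphism_apply1)
      then show ?thesis
        using inj_onD[OF \<open>inj_on p V\<close>, of "g b" "h b"] inj_onD[OF \<open>inj_on p V\<close>, of "g y" "h y"]
          True y b V(2) W(2) eq by (simp add: R_def)
    next
      case False
      then have "V \<inter> W = {}"
        using v(4) V(1) W(1) by (auto simp: pairwise_def disjnt_def)
      then show ?thesis
        using y V(2) W(2) by (auto simp: R_def)
    qed
    ultimately show "\<exists>T. openin (top_of_set S) T \<and> b \<in> T \<and> (\<forall>y\<in>T. R b y)"
      using b V(2) W(2) by (metis IntI vimageI)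
  qed
  then show ?thesis
    using a(2) by (simp add: R_def)
qed

text \<open>Values outside \<open>ideal_simplex n\<close> are left free, so that a lift followed by
  \<open>act k\<close> is again a lift.\<close>

definition is_lift :: "'b::topological_space set \<Rightarrow> ('b \<Rightarrow> 'a) \<Rightarrow> nat \<Rightarrow> 'a simplex_map \<Rightarrow> 'b simplex_map \<Rightarrow> bool" where
  "is_lift Mt p n f g \<longleftrightarrow> continuous_on (ideal_simplex n) g \<and>
     (\<forall>x\<in>ideal_simplex n. g x \<in> Mt \<and> p (g x) = f x)"

lemma ideal_simplex_iff:
  "x \<in> ideal_simplex n \<longleftrightarrow>
     (\<forall>i. 0 \<le> x i \<and> x i < 1) \<and> (\<forall>i>n. x i = 0) \<and> (\<Sum>i\<le>n. x i) = 1"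
  unfolding ideal_simplex_def standard_simplex_def by (auto simp: less_imp_le)

text \<open>Deleting the vertices preserves convexity, because a convex combination of numbers below
  1 stays below 1.\<close>

lemma connected_ideal_simplex: "connected (ideal_simplex n)"
proof (rule iffD2[OF connected_iff_connected_component], intro ballI)
  fix x y assume x: "x \<in> ideal_simplex n" and y: "y \<in> ideal_simplex n"
  let ?h = "\<lambda>(t::real) i. (1 - t) * x i + t * y i"
  have "continuous_on {0..1} ?h"
  proof (rule continuous_on_coordinatewise_then_product)
    show "continuous_on {0..1} (\<lambda>t. (1 - t) * x i + t * y i)" for i
      by (intro continuous_on_add continuous_on_mult continuous_on_diff continuous_on_const continuous_on_id)
  qed
  then have "connected (?h ` {0..1})"
    by (rule connected_continuous_image) simp
  moreover have "?h ` {0..1} \<subseteq> ideal_simplex n"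
  proof clarify
    fix t :: real assume t: "t \<in> {0..1}"
    have "(1 - t) * x i + t * y i < 1" for i
      using convex_bound_lt[of "x i" 1 "y i" "1 - t" t] x y t by (auto simp: ideal_simplex_iff)
    then show "?h t \<in> ideal_simplex n"
      using x y t by (auto simp: ideal_simplex_iff sum.distrib simp flip: sum_distrib_left)
  qed
  moreover have "x \<in> ?h ` {0..1}" "y \<in> ?h ` {0..1}"
    using image_eqI[of x ?h 0 "{0..1}"] image_eqI[of y ?h 1 "{0..1}"] by simp_all
  ultimately show "connected_component (ideal_simplex n) x y"
    unfolding connected_component_def by blast
qed

lemma ideal_simplex_nonempty:
  assumes "0 < n"
  shows "ideal_simplex n \<noteq> {}"
proof -
  have "(\<lambda>i. if i \<le> 1 then 1 / 2 else 0) \<in> ideal_simplex n"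
  proof -
    have "(\<Sum>i\<le>n. if i \<le> 1 then 1 / 2 else 0 :: real) = (\<Sum>i\<in>{0, 1::nat}. 1 / 2)"
      by (rule sum.mono_neutral_cong_right) (use assms in auto)
    then show ?thesis
      using assms by (auto simp: ideal_simplex_iff)
  qed
  then show ?thesis by blast
qed

text \<open>In barycentric coordinates, the affine map that takes vertex \<open>i\<close> to vertex
  \<open>vs ! i\<close>.\<close>

definition embed_simplex :: "nat list \<Rightarrow> (nat \<Rightarrow> real) \<Rightarrow> nat \<Rightarrow> real" where
  "embed_simplex vs x v = (\<Sum>i<length vs. if vs ! i = v then x i else 0)"

lemma subsimplex_eq_embed:
  "subsimplex s vs = restrict (\<lambda>x. s (embed_simplex vs x)) (ideal_simplex (length vs - 1))"
  unfolding subsimplex_def embed_simplex_def by simp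

lemma embed_simplex_nth:
  assumes "distinct vs" "j < length vs"
  shows "embed_simplex vs x (vs ! j) = x j"
proof -
  have "embed_simplex vs x (vs ! j) = (\<Sum>i<length vs. if i = j then x i else 0)"
    unfolding embed_simplex_def
    using assms by (intro sum.cong) (auto simp: nth_eq_iff_index_eq)
  then show ?thesis using assms by simp
qed

lemma embed_simplex_notin: "v \<notin> set vs \<Longrightarrow> embed_simplex vs x v = 0"
  unfolding embed_simplex_def by (intro sum.neutral) auto

lemma embed_simplex_in_ideal_simplex:
  assumes vs: "distinct vs" "vs \<noteq> []" "set vs \<subseteq> {..n}" and x: "x \<in> ideal_simplex (length vs - 1)"
  shows "embed_simplex vs x \<in> ideal_simplex n"
proof -
  have *: "0 \<le> embed_simplex vs x v \<and> embed_simplex vs x v < 1" for v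
  proof (cases "v \<in> set vs")
    case True
    then obtain j where "j < length vs" "v = vs ! j" by (metis in_set_conv_nth)
    then show ?thesis using x vs by (simp add: embed_simplex_nth ideal_simplex_iff)
  qed (simp add: embed_simplex_notin)
  have "(\<Sum>v\<le>n. embed_simplex vs x v) = (\<Sum>v\<in>set vs. embed_simplex vs x v)"
    using vs(3) by (intro sum.mono_neutral_right) (auto simp: embed_simplex_notin)
  also have "\<dots> = (\<Sum>i<length vs. embed_simplex vs x (vs ! i))"
    using vs(1) by (intro sum.reindex_bij_betw[symmetric] bij_betw_nth) auto
  also have "\<dots> = (\<Sum>i\<le>length vs - 1. x i)"
    using vs by (intro sum.cong) (auto simp: embed_simplex_nth less_Suc_eq_le simp flip: length_greater_0_conv)
  also have "\<dots> = 1"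
    using x by (simp add: ideal_simplex_iff)
  finally show ?thesis
    using * vs(3) by (auto simp: ideal_simplex_iff intro!: embed_simplex_notin)
qed

lemma continuous_on_embed_simplex: "continuous_on S (embed_simplex vs)"
proof (rule continuous_on_coordinatewise_then_product)
  fix v
  have "continuous_on S (\<lambda>x. if vs ! i = v then x i else 0)" for i
    by (cases "vs ! i = v") (auto intro: continuous_on_subset[OF continuous_on_product_coordinates])
  then show "continuous_on S (\<lambda>x. embed_simplex vs x v)"
    unfolding embed_simplex_def by (intro continuous_on_sum)
qed

lemma embed_simplex_embed_simplex:
  assumes "set ws \<subseteq> {..<length vs}"
  shows "embed_simplex vs (embed_simplex ws x) = embed_simplex (map ((!) vs) ws) x"
proof
  fix v
  have *: "(if vs ! i = v then embed_simplex ws x i else 0)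
      = (\<Sum>j<length ws. if ws ! j = i \<and> vs ! i = v then x j else 0)" for i
    by (auto simp: embed_simplex_def)
  have "embed_simplex vs (embed_simplex ws x) v
      = (\<Sum>j<length ws. \<Sum>i<length vs. if ws ! j = i \<and> vs ! i = v then x j else 0)"
    unfolding embed_simplex_def[of vs] * by (rule sum.swap)
  also have "\<dots> = (\<Sum>j<length ws. if vs ! (ws ! j) = v then x j else 0)"
  proof (intro sum.cong refl)
    fix j assume "j \<in> {..<length ws}"
    then have "ws ! j < length vs" using assms by (auto dest!: nth_mem)
    then show "(\<Sum>i<length vs. if ws ! j = i \<and> vs ! i = v then x j else 0)
       = (if vs ! (ws ! j) = v then x j else 0)"
      by (subst sum.mono_neutral_right[of _ "{ws ! j}"]) auto
  qed
  finally show "embed_simplex vs (embed_simplex ws x) v = embed_simplex (map ((!) vs) ws) x v"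
    by (simp add: embed_simplex_def)
qed

text \<open>Composition of affine maps given on vertices. It identifies the faces and edges of the
  new tetrahedra, which are themselves subsimplices of the bipyramid.\<close>

lemma subsimplex_subsimplex:
  assumes "distinct ws" "ws \<noteq> []" "set ws \<subseteq> {..<length vs}"
  shows "subsimplex (subsimplex s vs) ws = subsimplex s (map ((!) vs) ws)"
proof -
  have "embed_simplex ws x \<in> ideal_simplex (length vs - 1)" if "x \<in> ideal_simplex (length ws - 1)" for x
    using assms that by (intro embed_simplex_in_ideal_simplex) auto
  then show ?thesis
    by (auto simp: subsimplex_eq_embed embed_simplex_embed_simplex[OF assms(3)] intro!: restrict_ext)
qed

lemma is_lift_subsimplex:
  assumes lift: "is_lift Mt p n s g" and vs: "distinct vs" "vs \<noteq> []" "set vs \<subseteq> {..n}"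
  shows "is_lift Mt p (length vs - 1) (subsimplex s vs) (subsimplex g vs)"
proof -
  let ?I = "ideal_simplex (length vs - 1)"
  have emb: "embed_simplex vs ` ?I \<subseteq> ideal_simplex n"
    using vs by (auto intro: embed_simplex_in_ideal_simplex)
  have "continuous_on ?I (\<lambda>x. g (embed_simplex vs x))"
    using lift emb unfolding is_lift_def
    by (intro continuous_on_compose2[OF _ continuous_on_embed_simplex]) auto
  then have "continuous_on ?I (subsimplex g vs)"
    by (rule continuous_on_eq) (simp add: subsimplex_eq_embed)
  then show ?thesis
    using lift emb unfolding is_lift_def by (auto simp: subsimplex_eq_embed image_subset_iff)
qed

section \<open>Deck transformations and the exponents of \<open>t\<close>\<close>

locale cyclic_cover =
  fixes M :: "'a::topological_space set" and Mt :: "'b::topological_space set"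
    and p :: "'b \<Rightarrow> 'a" and act :: "int \<Rightarrow> 'b \<Rightarrow> 'b"
  assumes infinite_cyclic_cover: "infinite_cyclic_cover M Mt p act"
begin

lemma covering: "covering_space Mt p M"
  and connected_cover: "connected Mt"
  and bij_act: "bij_betw act UNIV (deck_transformations Mt p)"
  and act_add: "x \<in> Mt \<Longrightarrow> act (j + k) x = act j (act k x)"
  and act_transitive: "x \<in> Mt \<Longrightarrow> y \<in> Mt \<Longrightarrow> p x = p y \<Longrightarrow> \<exists>k. y = act k x"
  using infinite_cyclic_cover unfolding infinite_cyclic_cover_def by simp_all

lemma act_deck: "act k \<in> deck_transformations Mt p"
  using bij_act by (auto simp: bij_betw_def)

lemma continuous_on_act: "continuous_on Mt (act k)"
  and act_in_cover: "x \<in> Mt \<Longrightarrow> act k x \<in> Mt"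
  and proj_act: "x \<in> Mt \<Longrightarrow> p (act k x) = p x"
  and inj_on_act: "inj_on (act k) Mt"
proof -
  obtain h where "homeomorphism Mt Mt (act k) h"
    using act_deck[of k] unfolding deck_transformations_def by blast
  then show "continuous_on Mt (act k)" "x \<in> Mt \<Longrightarrow> act k x \<in> Mt" "inj_on (act k) Mt"
    by (auto simp: homeomorphism_def intro: inj_on_inverseI)
  show "x \<in> Mt \<Longrightarrow> p (act k x) = p x"
    using act_deck[of k] unfolding deck_transformations_def by blast
qed

text \<open>By additivity \<open>act 0\<close> is idempotent, and an injective idempotent is the
  identity.\<close>

lemma act_zero: "x \<in> Mt \<Longrightarrow> act 0 x = x"
  using act_add[of x 0 0] inj_onD[OF inj_on_act[of 0], of "act 0 x" x] act_in_cover[of x 0] by simp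

text \<open>Deck transformations are lifts of \<open>p\<close> through itself, so on the connected
  cover two of them that agree at one point agree everywhere. Being extensional they are then equal
  as functions, and \<open>act\<close> is injective. This makes the exponents of \<open>t\<close>
  well defined.\<close>

lemma act_free:
  assumes x: "x \<in> Mt" and eq: "act j x = act k x"
  shows "j = k"
proof -
  have "act j y = act k y" if "y \<in> Mt" for y
    by (rule covering_lift_unique[where g = "act j" and h = "act k", OF covering connected_cover _ _ _ _ _ x eq that])
       (auto simp: continuous_on_act act_in_cover proj_act)
  moreover have "act j \<in> extensional Mt" "act k \<in> extensional Mt"
    using act_deck unfolding deck_transformations_def by auto
  ultimately have "act j = act k"
    by (intro extensionalityI) auto
  then show ?thesis
    using bij_act by (auto simp: bij_betw_def dest: injD)
qed

lemma is_lift_act: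
  assumes "is_lift Mt p n f g"
  shows "is_lift Mt p n f (\<lambda>x. act k (g x))"
proof -
  have "continuous_on (ideal_simplex n) (\<lambda>x. act k (g x))"
    using assms unfolding is_lift_def
    by (intro continuous_on_compose2[OF continuous_on_act]) auto
  then show ?thesis
    using assms unfolding is_lift_def by (auto simp: act_in_cover proj_act)
qed

text \<open>Transitivity on fibres yields \<open>k\<close> at one point, and uniqueness of lifts
  extends the equation over the connected ideal simplex.\<close>

lemma lift_eq_act:
  assumes n: "0 < n" and g: "is_lift Mt p n f g" and h: "is_lift Mt p n f h"
  shows "\<exists>k. \<forall>x\<in>ideal_simplex n. g x = act k (h x)"
proof -
  obtain a where a: "a \<in> ideal_simplex n"
    using ideal_simplex_nonempty[OF n] by blast
  obtain k where k: "g a = act k (h a)"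
    using act_transitive[of "h a" "g a"] g h a unfolding is_lift_def by auto
  have h': "is_lift Mt p n f (\<lambda>x. act k (h x))"
    using h by (rule is_lift_act)
  have "g x = act k (h x)" if "x \<in> ideal_simplex n" for x
    by (rule covering_lift_unique[where g = g and h = "\<lambda>x. act k (h x)",
          OF covering connected_ideal_simplex[of n] _ _ _ _ _ a k that])
       (use g h' in \<open>auto simp: is_lift_def\<close>)
  then show ?thesis by blast
qed

text \<open>The exponent \<open>twist\<close> with both lifts as arguments, so that the lifts of
  tetrahedra and those of faces can be chosen separately.\<close>

definition gain :: "'b simplex_map \<Rightarrow> 'b simplex_map \<Rightarrow> int" where
  "gain g h = (THE k. \<forall>x\<in>ideal_simplex 2. g x = act k (h x))"

lemma twist_eq_gain: "twist act L s i = gain (face (L s) i) (L (face s i))"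
  unfolding twist_def gain_def ..

lemma gain_eqI:
  assumes "is_lift Mt p 2 f h" and "\<And>x. x \<in> ideal_simplex 2 \<Longrightarrow> g x = act k (h x)"
  shows "gain g h = k"
proof -
  obtain a where a: "a \<in> ideal_simplex 2"
    using ideal_simplex_nonempty[of 2] by auto
  have "h a \<in> Mt" using assms(1) a unfolding is_lift_def by blast
  then show ?thesis
    unfolding gain_def using assms(2) a by (intro the_equality) (auto intro: act_free)
qed

lemma gain_self: "is_lift Mt p 2 f h \<Longrightarrow> gain h h = 0"
  by (rule gain_eqI) (auto simp: is_lift_def act_zero)

lemma gain_act:
  assumes "is_lift Mt p 2 f g" "is_lift Mt p 2 f h" "x \<in> ideal_simplex 2"
  shows "g x = act (gain g h) (h x)"
proof -
  obtain k where k: "\<forall>x\<in>ideal_simplex 2. g x = act k (h x)"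
    using lift_eq_act[of 2 f g h] assms by auto
  then have "gain g h = k"
    using assms(2) by (intro gain_eqI) auto
  then show ?thesis using k assms(3) by simp
qed

lemma is_lift_face:
  assumes "is_lift Mt p 3 s g" "i < 4"
  shows "is_lift Mt p 2 (face s i) (face g i)"
proof -
  have "distinct (remove1 i [0, 1, 2, 3])" "remove1 i [0, 1, 2, 3] \<noteq> []"
    "set (remove1 i [0, 1, 2, 3]) \<subseteq> {..3}" "length (remove1 i [0, 1, 2, 3]) - 1 = 2"
    using assms(2) by (auto simp: less_4_iff)
  from is_lift_subsimplex[OF assms(1) this(1-3)] this(4) show ?thesis by simp
qed

text \<open>Exponents add up along the chain \<open>face (g s) i\<close>,
  \<open>face (g' s) i\<close>, \<open>h' (face s i)\<close>, \<open>h (face s i)\<close>. The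
  correction \<open>a\<close> depends on the tetrahedron alone and \<open>b\<close> on the face
  alone, which makes them a row factor and a column factor.\<close>

lemma gain_change_lifts:
  assumes g: "\<And>s. s \<in> T \<Longrightarrow> is_lift Mt p 3 s (g s)" and g': "\<And>s. s \<in> T \<Longrightarrow> is_lift Mt p 3 s (g' s)"
    and h: "\<And>s i. s \<in> T \<Longrightarrow> i < 4 \<Longrightarrow> is_lift Mt p 2 (face s i) (h (face s i))"
    and h': "\<And>s i. s \<in> T \<Longrightarrow> i < 4 \<Longrightarrow> is_lift Mt p 2 (face s i) (h' (face s i))"
  shows "\<exists>a b. \<forall>s\<in>T. \<forall>i<4.
    gain (face (g s) i) (h (face s i)) = a s + gain (face (g' s) i) (h' (face s i)) + b (face s i)"
proof -
  have "\<forall>s\<in>T. \<exists>k. \<forall>x\<in>ideal_simplex 3. g s x = act k (g' s x)"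
    using lift_eq_act[OF _ g g'] by simp
  then obtain a where a: "\<And>s x. s \<in> T \<Longrightarrow> x \<in> ideal_simplex 3 \<Longrightarrow> g s x = act (a s) (g' s x)"
    by metis
  define b where "b f = gain (h' f) (h f)" for f
  have "gain (face (g s) i) (h (face s i)) = a s + gain (face (g' s) i) (h' (face s i)) + b (face s i)"
    if s: "s \<in> T" and i: "i < 4" for s i
  proof (rule gain_eqI[OF h[OF s i]])
    fix x assume x: "x \<in> ideal_simplex 2"
    let ?f = "face s i" and ?k = "gain (face (g' s) i) (h' (face s i))"
    have emb: "embed_simplex (remove1 i [0, 1, 2, 3]) x \<in> ideal_simplex 3"
      using x i by (intro embed_simplex_in_ideal_simplex) (auto simp: less_4_iff simp flip: numeral_2_eq_2)
    have hx: "h ?f x \<in> Mt"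
      using h[OF s i] x unfolding is_lift_def by blast
    have len: "length (remove1 i [0, 1, 2, 3]) - 1 = 2"
      using i by (auto simp: less_4_iff)
    have "face (g s) i x = act (a s) (face (g' s) i x)"
      using x unfolding subsimplex_eq_embed len restrict_apply by (simp only: if_True a[OF s emb])
    also have "face (g' s) i x = act ?k (h' ?f x)"
      by (rule gain_act[OF is_lift_face[OF g'[OF s] i] h'[OF s i] x])
    also have "h' ?f x = act (b ?f) (h ?f x)"
      unfolding b_def by (rule gain_act[OF h'[OF s i] h[OF s i] x])
    also have "act (a s) (act ?k (act (b ?f) (h ?f x))) = act (a s + ?k + b ?f) (h ?f x)"
      using hx by (simp add: act_add act_in_cover)
    finally show "face (g s) i x = act (a s + ?k + b ?f) (h ?f x)" .
  qed
  then show ?thesis by blast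
qed

end

section \<open>The bipyramid\<close>

lemma ideal_simplex_3_iff:
  "x \<in> ideal_simplex 3 \<longleftrightarrow>
     (\<forall>i. 0 \<le> x i \<and> x i < 1) \<and> (\<forall>i>3. x i = 0) \<and> x 0 + x 1 + x 2 + x 3 = 1"
  by (simp add: ideal_simplex_iff eval_nat_numeral ac_simps)

lemma ideal_simplex_4_iff:
  "x \<in> ideal_simplex 4 \<longleftrightarrow>
     (\<forall>i. 0 \<le> x i \<and> x i < 1) \<and> (\<forall>i>4. x i = 0) \<and> x 0 + x 1 + x 2 + x 3 + x 4 = 1"
  by (simp add: ideal_simplex_iff eval_nat_numeral ac_simps)

text \<open>Coordinates of a point of the bipyramid in the tetrahedron with apex \<open>k\<close>,
  which is \<open>s\<close> for 0 and \<open>r\<close> for 1: entry 0 is the weight of the apex,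
  entry \<open>v\<close> that of the vertex \<open>v + 1\<close> of the bipyramid.\<close>

definition bipyramid_chart :: "nat \<Rightarrow> (nat \<Rightarrow> real) \<Rightarrow> nat \<Rightarrow> real" where
  "bipyramid_chart k x v =
     (if v = 0 then x k - min (x 0) (x 1)
      else if v \<in> {1, 2, 3} then x (v + 1) + 2 / 3 * min (x 0) (x 1) else 0)"

lemma bipyramid_eq_chart:
  "bipyramid s r x = (if x 1 \<le> x 0 then s (bipyramid_chart 0 x) else r (bipyramid_chart 1 x))"
proof -
  have "(\<lambda>v. if v \<in> {1, 2, 3} then x (v + 1) + 2 / 3 * min (x 0) (x 1) else 0)
      (0 := x k - min (x 0) (x 1)) = bipyramid_chart k x" for k
    by (auto simp: bipyramid_chart_def fun_upd_def)
  then show ?thesis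
    unfolding bipyramid_def Let_def by (simp only:)
qed

text \<open>With \<open>m\<close> the smaller apex weight, the total 2 m taken from the apices is
  spread in three equal parts of 2/3 m over the triangle, so the sum stays 1. The inequality says
  that \<open>k\<close> is the heavier apex.\<close>

lemma bipyramid_chart_in_ideal_simplex:
  assumes x: "x \<in> ideal_simplex 4" and k: "k < 2" "x (1 - k) \<le> x k"
  shows "bipyramid_chart k x \<in> ideal_simplex 3"
proof -
  have *: "\<forall>i. 0 \<le> x i \<and> x i < 1" and sum: "x 0 + x 1 + x 2 + x 3 + x 4 = 1"
    using x by (simp_all add: ideal_simplex_4_iff)
  have k': "k = 0 \<or> k = 1" using k by auto
  have m: "min (x 0) (x 1) = x (1 - k)" using k k' by auto
  have "x 0 < 1" "x 1 < 1" "x 2 < 1" "x 3 < 1" "x 4 < 1" "0 \<le> x 0" "0 \<le> x 1" "0 \<le> x 2" "0 \<le> x 3" "0 \<le> x 4"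
    using * by auto
  then have "0 \<le> bipyramid_chart k x v \<and> bipyramid_chart k x v < 1" for v
    using sum k k' unfolding bipyramid_chart_def m by (auto simp del: One_nat_def)
  moreover have "bipyramid_chart k x 0 + bipyramid_chart k x 1 + bipyramid_chart k x 2 + bipyramid_chart k x 3 = 1"
    using sum k' unfolding bipyramid_chart_def m by (auto simp del: One_nat_def)
  ultimately show ?thesis
    by (auto simp: ideal_simplex_3_iff bipyramid_chart_def)
qed

lemma continuous_on_bipyramid_chart: "continuous_on S (bipyramid_chart k)"
proof (rule continuous_on_coordinatewise_then_product)
  have c: "continuous_on S (\<lambda>x :: nat \<Rightarrow> real. x i)" for i
    by (rule continuous_on_subset[OF continuous_on_product_coordinates]) simp
  fix v :: nat
  consider "v = 0" | "v \<in> {1, 2, 3}" | "v \<notin> {0, 1, 2, 3}" by blast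
  then show "continuous_on S (\<lambda>x. bipyramid_chart k x v)"
  proof cases
    case 1
    then show ?thesis
      by (simp add: bipyramid_chart_def) (intro continuous_on_diff continuous_on_min c)
  next
    case 2
    then have "(\<lambda>x. bipyramid_chart k x v) = (\<lambda>x. x (v + 1) + 2 / 3 * min (x 0) (x 1))"
      by (auto simp: bipyramid_chart_def)
    then show ?thesis
      by (simp only:) (intro continuous_on_add continuous_on_mult continuous_on_const continuous_on_min c)
  next
    case 3
    then show ?thesis by (simp add: bipyramid_chart_def)
  qed
qed

text \<open>The gluing condition on points of the tetrahedra: this is the form needed where the two
  charts of the bipyramid meet, both downstairs and for the lifts.\<close>

definition agree_on_face_0 :: "'a simplex_map \<Rightarrow> 'a simplex_map \<Rightarrow> bool" where
  "agree_on_face_0 s r \<longleftrightarrow> (\<forall>x\<in>ideal_simplex 3. x 0 = 0 \<longrightarrow> s x = r x)"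

lemma agree_on_face_0I:
  assumes "\<And>x. x \<in> ideal_simplex 2 \<Longrightarrow> face s 0 x = face r 0 x"
  shows "agree_on_face_0 s r"
  unfolding agree_on_face_0_def
proof (intro ballI impI)
  fix x assume x: "x \<in> ideal_simplex 3" "x 0 = 0"
  let ?y = "\<lambda>i. x (i + 1)"
  have y: "?y \<in> ideal_simplex 2"
    using x by (auto simp: ideal_simplex_iff eval_nat_numeral ac_simps)
  have "embed_simplex [1, 2, 3] ?y = x"
  proof
    fix v :: nat
    consider "v = 0" | "v = 1" | "v = 2" | "v = 3" | "v > 3" by linarith
    then show "embed_simplex [1, 2, 3] ?y v = x v"
      using x unfolding ideal_simplex_3_iff by cases (auto simp: embed_simplex_def eval_nat_numeral)
  qed
  then show "s x = r x"
    using assms[OF y] y by (simp add: subsimplex_eq_embed flip: numeral_2_eq_2)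
qed

text \<open>The two halves meet where \<open>x 0 = x 1\<close>. There both charts give the same
  point with apex weight 0, a point of the glued face, so the lifts paste to a continuous
  map.\<close>

lemma is_lift_bipyramid:
  assumes s: "is_lift Mt p 3 s g" and r: "is_lift Mt p 3 r h" and agree: "agree_on_face_0 g h"
  shows "is_lift Mt p 4 (bipyramid s r) (bipyramid g h)"
proof -
  let ?I = "ideal_simplex 4"
  have "continuous_on ?I (\<lambda>x. if x 1 - x 0 \<le> 0 then g (bipyramid_chart 0 x) else h (bipyramid_chart 1 x))"
  proof (rule continuous_on_cases_le)
    show "continuous_on {t \<in> ?I. t 1 - t 0 \<le> 0} (\<lambda>x. g (bipyramid_chart 0 x))"
      using s unfolding is_lift_def
      by (intro continuous_on_compose2[OF _ continuous_on_bipyramid_chart])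
         (auto intro: bipyramid_chart_in_ideal_simplex)
    show "continuous_on {t \<in> ?I. 0 \<le> t 1 - t 0} (\<lambda>x. h (bipyramid_chart 1 x))"
      using r unfolding is_lift_def
      by (intro continuous_on_compose2[OF _ continuous_on_bipyramid_chart])
         (auto intro: bipyramid_chart_in_ideal_simplex)
    show "continuous_on ?I (\<lambda>x. x 1 - x 0)"
      by (intro continuous_on_diff continuous_on_subset[OF continuous_on_product_coordinates]) auto
    fix x assume x: "x \<in> ?I" "x 1 - x 0 = 0"
    have "bipyramid_chart 0 x = bipyramid_chart 1 x" "bipyramid_chart 1 x 0 = 0"
      using x by (auto simp: bipyramid_chart_def)
    moreover have "bipyramid_chart 1 x \<in> ideal_simplex 3"
      using x by (intro bipyramid_chart_in_ideal_simplex) auto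
    ultimately show "g (bipyramid_chart 0 x) = h (bipyramid_chart 1 x)"
      using agree unfolding agree_on_face_0_def by auto
  qed
  then have "continuous_on ?I (bipyramid g h)"
    by (rule continuous_on_eq) (simp add: bipyramid_eq_chart)
  moreover have "bipyramid g h x \<in> Mt \<and> p (bipyramid g h x) = bipyramid s r x" if "x \<in> ?I" for x
    using s r bipyramid_chart_in_ideal_simplex[OF that, of 0] bipyramid_chart_in_ideal_simplex[OF that, of 1]
    unfolding is_lift_def bipyramid_eq_chart by auto
  ultimately show ?thesis
    unfolding is_lift_def by blast
qed

lemma embed_simplex_nonneg:
  assumes "\<And>i. 0 \<le> x i"
  shows "0 \<le> embed_simplex vs x v"
  unfolding embed_simplex_def using assms by (intro sum_nonneg) auto

text \<open>Without vertex 1 nothing is spread, and the chart merely renumbers. Truncated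
  subtraction keeps 0 at 0, so \<open>v - 1\<close> takes 0, 2, 3, 4 to the numbering 0, 1, 2, 3 of
  \<open>s\<close>.\<close>

lemma subsimplex_bipyramid_0:
  assumes "set vs \<subseteq> {0, 2, 3, 4}"
  shows "subsimplex (bipyramid s r) vs = subsimplex s (map (\<lambda>v. v - 1) vs)"
proof -
  have "bipyramid s r (embed_simplex vs x) = s (embed_simplex (map (\<lambda>v. v - 1) vs) x)"
    if x: "x \<in> ideal_simplex (length vs - 1)" for x
  proof -
    let ?e = "embed_simplex vs x"
    have nth: "vs ! i \<in> {0, 2, 3, 4}" if "i < length vs" for i
      using assms that nth_mem by blast
    have e: "?e 1 = 0" "0 \<le> ?e 0"
      using assms x by (auto simp: ideal_simplex_iff intro!: embed_simplex_nonneg embed_simplex_notin)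
    have "bipyramid_chart 0 ?e v = embed_simplex (map (\<lambda>v. v - 1) vs) x v" for v
    proof -
      consider "v = 0" | "v \<in> {1, 2, 3}" | "v \<notin> {0, 1, 2, 3}" by blast
      then show ?thesis
      proof cases
        case 1
        then have "bipyramid_chart 0 ?e v = ?e 0"
          using e by (simp add: bipyramid_chart_def)
        also have "\<dots> = embed_simplex (map (\<lambda>v. v - 1) vs) x v"
          unfolding embed_simplex_def using nth 1 by (intro sum.cong) fastforce+
        finally show ?thesis .
      next
        case 2
        then have "bipyramid_chart 0 ?e v = ?e (v + 1)"
          using e by (auto simp: bipyramid_chart_def)
        also have "\<dots> = embed_simplex (map (\<lambda>v. v - 1) vs) x v"
          unfolding embed_simplex_def using nth 2 by (intro sum.cong) auto
        finally show ?thesis .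
      next
        case 3
        then have "v \<notin> set (map (\<lambda>v. v - 1) vs)"
          using assms by auto
        then show ?thesis
          using 3 by (simp add: bipyramid_chart_def embed_simplex_notin)
      qed
    qed
    then have "bipyramid_chart 0 ?e = embed_simplex (map (\<lambda>v. v - 1) vs) x" by blast
    then show ?thesis using e by (simp add: bipyramid_eq_chart)
  qed
  then show ?thesis by (auto simp: subsimplex_eq_embed intro!: restrict_ext)
qed

text \<open>As for \<open>s\<close>, except that points with weight 0 at both apices fall into the
  branch of \<open>s\<close>; on these the agreement along the common face is invoked.\<close>

lemma subsimplex_bipyramid_1:
  assumes vs: "distinct vs" "vs \<noteq> []" "set vs \<subseteq> {1, 2, 3, 4}" and agree: "agree_on_face_0 s r"
  shows "subsimplex (bipyramid s r) vs = subsimplex r (map (\<lambda>v. v - 1) vs)"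
proof -
  have "bipyramid s r (embed_simplex vs x) = r (embed_simplex (map (\<lambda>v. v - 1) vs) x)"
    if x: "x \<in> ideal_simplex (length vs - 1)" for x
  proof -
    let ?e = "embed_simplex vs x"
    have e4: "?e \<in> ideal_simplex 4"
      using vs x by (intro embed_simplex_in_ideal_simplex) auto
    have nth: "vs ! i \<in> {1, 2, 3, 4}" if "i < length vs" for i
      using vs that nth_mem by blast
    have e: "?e 0 = 0" "0 \<le> ?e 1"
      using vs x by (auto simp: ideal_simplex_iff intro!: embed_simplex_nonneg embed_simplex_notin)
    have "bipyramid_chart 1 ?e v = embed_simplex (map (\<lambda>v. v - 1) vs) x v" for v
    proof (cases "v < 4")
      case True
      then have "bipyramid_chart 1 ?e v = ?e (v + 1)"
        using e by (auto simp: bipyramid_chart_def less_4_iff)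
      also have "\<dots> = embed_simplex (map (\<lambda>v. v - 1) vs) x v"
        unfolding embed_simplex_def using nth by (intro sum.cong) fastforce+
      finally show ?thesis .
    next
      case False
      then have "v \<notin> set (map (\<lambda>v. v - 1) vs)"
        using vs by auto
      then show ?thesis
        using False by (simp add: bipyramid_chart_def embed_simplex_notin)
    qed
    then have chart: "bipyramid_chart 1 ?e = embed_simplex (map (\<lambda>v. v - 1) vs) x" by blast
    show ?thesis
    proof (cases "?e 1 \<le> ?e 0")
      case True
      then have "?e 1 = 0" using e by simp
      then have "bipyramid_chart 0 ?e = bipyramid_chart 1 ?e" "bipyramid_chart 1 ?e 0 = 0"
        using e by (auto simp: bipyramid_chart_def)
      moreover have "bipyramid_chart 1 ?e \<in> ideal_simplex 3"
        using e e4 by (intro bipyramid_chart_in_ideal_simplex) auto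
      ultimately have "s (bipyramid_chart 0 ?e) = r (bipyramid_chart 1 ?e)"
        using agree unfolding agree_on_face_0_def by auto
      then show ?thesis using True chart by (simp add: bipyramid_eq_chart)
    next
      case False
      then show ?thesis using chart by (simp add: bipyramid_eq_chart)
    qed
  qed
  then show ?thesis by (auto simp: subsimplex_eq_embed intro!: restrict_ext)
qed

section \<open>The cells of the two triangulations\<close>

lemma face_simps:
  "face s 0 = subsimplex s [1, 2, 3]" "face s 1 = subsimplex s [0, 2, 3]"
  "face s 2 = subsimplex s [0, 1, 3]" "face s 3 = subsimplex s [0, 1, 2]"
  by simp_all

lemma cells_1:
  "cells 1 T = (\<Union>s\<in>T. {edge s 0 1, edge s 0 2, edge s 0 3, edge s 1 2, edge s 1 3, edge s 2 3})"
proof -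
  have *: "(sorted_wrt (<) vs \<and> set vs \<subseteq> {0, 1, 2, 3} \<and> length vs = 1 + 1)
      \<longleftrightarrow> vs \<in> {[0, 1], [0, 2], [0, 3], [1, 2], [1, 3], [2, 3]}" for vs :: "nat list"
    by (cases vs; cases "tl vs"; cases "tl (tl vs)") auto
  show ?thesis
    unfolding cells_def * by blast
qed

lemma cells_2: "cells 2 T = (\<Union>s\<in>T. {face s 0, face s 1, face s 2, face s 3})"
proof -
  have *: "(sorted_wrt (<) vs \<and> set vs \<subseteq> {0, 1, 2, 3} \<and> length vs = 2 + 1)
      \<longleftrightarrow> vs \<in> {[1, 2, 3], [0, 2, 3], [0, 1, 3], [0, 1, 2]}" for vs :: "nat list"
    by (cases vs; cases "tl vs"; cases "tl (tl vs)"; cases "tl (tl (tl vs))") auto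
  show ?thesis
    unfolding cells_def * face_simps by blast
qed

lemma face_in_cells: "s \<in> T \<Longrightarrow> k < 4 \<Longrightarrow> face s k \<in> cells 2 T"
  unfolding cells_2 less_4_iff by blast

lemma subsimplex_0123:
  assumes "s \<in> extensional (ideal_simplex 3)"
  shows "subsimplex s [0, 1, 2, 3] = s"
proof -
  have *: "embed_simplex [0, 1, 2, 3] x = x" if "x \<in> ideal_simplex 3" for x
  proof
    fix v :: nat
    consider "v = 0" | "v = 1" | "v = 2" | "v = 3" | "v > 3" by linarith
    then show "embed_simplex [0, 1, 2, 3] x v = x v"
      using that unfolding ideal_simplex_3_iff by cases (auto simp: embed_simplex_def eval_nat_numeral)
  qed
  have "length [0, 1, 2, 3 :: nat] - 1 = 3" by simp
  then show ?thesis
    unfolding subsimplex_eq_embed by (intro extensionalityI[OF _ assms]) (simp_all only: restrict_extensional restrict_apply if_True *)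
qed

lemma cells_3:
  assumes "\<And>s. s \<in> T \<Longrightarrow> s \<in> extensional (ideal_simplex 3)"
  shows "cells 3 T = T"
proof -
  have "(sorted_wrt (<) vs \<and> set vs \<subseteq> {0, 1, 2, 3} \<and> length vs = 3 + 1)
      \<longleftrightarrow> vs = [0, 1, 2, 3]" for vs :: "nat list"
    by (cases vs; cases "tl vs"; cases "tl (tl vs)"; cases "tl (tl (tl vs))"; cases "tl (tl (tl (tl vs)))") auto
  note * = this
  have "cells 3 T = (\<lambda>s. subsimplex s [0, 1, 2, 3]) ` T"
    unfolding cells_def * by auto
  also have "\<dots> = T"
    using subsimplex_0123[OF assms] by force
  finally show ?thesis .
qed

lemma open_simplex_subset_ideal_simplex:
  assumes "0 < n"
  shows "open_simplex n \<subseteq> ideal_simplex n"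
proof
  fix x assume x: "x \<in> open_simplex n"
  have "x i < 1" for i
  proof (cases "i \<le> n")
    case True
    define j where "j = (if i = 0 then 1 else 0 :: nat)"
    have j: "j \<le> n" "j \<noteq> i" using assms by (auto simp: j_def)
    have "x i + x j = sum x {i, j}" using j by simp
    also have "\<dots> \<le> sum x {..n}"
      using x True j by (intro sum_mono2) (auto simp: open_simplex_def standard_simplex_def)
    also have "\<dots> = 1" using x by (simp add: open_simplex_def standard_simplex_def)
    finally show ?thesis using x j unfolding open_simplex_def by force
  qed (use x in \<open>auto simp: open_simplex_def standard_simplex_def\<close>)
  then show "x \<in> ideal_simplex n"
    using x by (simp add: ideal_simplex_def open_simplex_def)
qed

text \<open>Faces 0 and 1 omit an apex and are outer faces of \<open>r\<close> and \<open>s\<close>;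
  faces 2 and 3 contain the segment \<open>[0,1]\<close>. The same pattern holds for the other two
  new tetrahedra.\<close>

lemma faces_bipyramid_0123:
  assumes "agree_on_face_0 s r"
  shows "face (subsimplex (bipyramid s r) [0, 1, 2, 3]) 0 = face r 3"
    "face (subsimplex (bipyramid s r) [0, 1, 2, 3]) 1 = face s 3"
    "face (subsimplex (bipyramid s r) [0, 1, 2, 3]) 2 = subsimplex (bipyramid s r) [0, 1, 3]"
    "face (subsimplex (bipyramid s r) [0, 1, 2, 3]) 3 = subsimplex (bipyramid s r) [0, 1, 2]"
  unfolding face_simps
  by (simp_all add: subsimplex_subsimplex subsimplex_bipyramid_0 subsimplex_bipyramid_1 assms eval_nat_numeral)

lemma faces_bipyramid_0134:
  assumes "agree_on_face_0 s r"
  shows "face (subsimplex (bipyramid s r) [0, 1, 3, 4]) 0 = face r 1"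
    "face (subsimplex (bipyramid s r) [0, 1, 3, 4]) 1 = face s 1"
    "face (subsimplex (bipyramid s r) [0, 1, 3, 4]) 2 = subsimplex (bipyramid s r) [0, 1, 4]"
    "face (subsimplex (bipyramid s r) [0, 1, 3, 4]) 3 = subsimplex (bipyramid s r) [0, 1, 3]"
  unfolding face_simps
  by (simp_all add: subsimplex_subsimplex subsimplex_bipyramid_0 subsimplex_bipyramid_1 assms eval_nat_numeral)

lemma faces_bipyramid_0124:
  assumes "agree_on_face_0 s r"
  shows "face (subsimplex (bipyramid s r) [0, 1, 2, 4]) 0 = face r 2"
    "face (subsimplex (bipyramid s r) [0, 1, 2, 4]) 1 = face s 2"
    "face (subsimplex (bipyramid s r) [0, 1, 2, 4]) 2 = subsimplex (bipyramid s r) [0, 1, 4]"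
    "face (subsimplex (bipyramid s r) [0, 1, 2, 4]) 3 = subsimplex (bipyramid s r) [0, 1, 2]"
  unfolding face_simps
  by (simp_all add: subsimplex_subsimplex subsimplex_bipyramid_0 subsimplex_bipyramid_1 assms eval_nat_numeral)

section \<open>The bipyramid inside a triangulation\<close>

locale pachner =
  fixes X :: "'a::topological_space set" and T :: "'a simplex_map set" and s r :: "'a simplex_map"
  assumes triangulation: "ideal_triangulation X T"
    and s: "s \<in> T" and r: "r \<in> T" and s_neq_r: "s \<noteq> r" and face_0: "face s 0 = face r 0"
begin

abbreviation "B \<equiv> bipyramid s r"
text \<open>The new tetrahedra are named after the vertex that they omit.\<close>

definition "tet4 = subsimplex B [0, 1, 2, 3]"
definition "tet2 = subsimplex B [0, 1, 3, 4]"
definition "tet3 = subsimplex B [0, 1, 2, 4]"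
definition "T' = T - {s, r} \<union> {tet4, tet2, tet3}"
definition "mid_face v = subsimplex B [0, 1, v]"
definition "central_edge = subsimplex B [0, 1]"

lemma finite_T: "finite T"
  and extensional_T: "t \<in> T \<Longrightarrow> t \<in> extensional (ideal_simplex 3)"
  and image_T: "t \<in> T \<Longrightarrow> t ` ideal_simplex 3 \<subseteq> X"
  and ex1_cell: "x \<in> X \<Longrightarrow> \<exists>!(n, u, y). n \<in> {1, 2, 3} \<and> u \<in> cells n T \<and> y \<in> open_simplex n \<and> u y = x"
  and card_face: "f \<in> cells 2 T \<Longrightarrow> card {(t, k). t \<in> T \<and> k < 4 \<and> face t k = f} = 2"
proof -
  note 1 = triangulation[unfolded ideal_triangulation_def]
  note 2 = conjunct2[OF 1] note 3 = conjunct2[OF 2] note 4 = conjunct2[OF 3] note 5 = conjunct2[OF 4]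
  show "finite T" using 1 by (rule conjunct1)
  show "t \<in> extensional (ideal_simplex 3)" "t ` ideal_simplex 3 \<subseteq> X" if "t \<in> T"
    using bspec[OF conjunct1[OF 2] that] by simp_all
  show "\<exists>!(n, u, y). n \<in> {1, 2, 3} \<and> u \<in> cells n T \<and> y \<in> open_simplex n \<and> u y = x" if "x \<in> X"
    using conjunct1[OF 3] that by (rule bspec)
  show "card {(t, k). t \<in> T \<and> k < 4 \<and> face t k = f} = 2" if "f \<in> cells 2 T"
    using 5 that by (rule bspec)
qed

lemma extensional_T': "t \<in> T' \<Longrightarrow> t \<in> extensional (ideal_simplex 3)"
  using extensional_T by (auto simp: T'_def tet4_def tet2_def tet3_def subsimplex_eq_embed numeral_3_eq_3)

lemma agree: "agree_on_face_0 s r"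
  by (rule agree_on_face_0I) (simp only: face_0)

lemma faces_tet4:
  "face tet4 0 = face r 3" "face tet4 1 = face s 3" "face tet4 2 = mid_face 3" "face tet4 3 = mid_face 2"
  unfolding tet4_def mid_face_def by (fact faces_bipyramid_0123[OF agree])+

lemma faces_tet2:
  "face tet2 0 = face r 1" "face tet2 1 = face s 1" "face tet2 2 = mid_face 4" "face tet2 3 = mid_face 3"
  unfolding tet2_def mid_face_def by (fact faces_bipyramid_0134[OF agree])+

lemma faces_tet3:
  "face tet3 0 = face r 2" "face tet3 1 = face s 2" "face tet3 2 = mid_face 4" "face tet3 3 = mid_face 2"
  unfolding tet3_def mid_face_def by (fact faces_bipyramid_0124[OF agree])+

lemma edges_face_0: "edge r 1 2 = edge s 1 2" "edge r 1 3 = edge s 1 3" "edge r 2 3 = edge s 2 3"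
proof -
  have "subsimplex (face s 0) vs = subsimplex (face r 0) vs" for vs
    by (simp only: face_0)
  from this[of "[0, 1]"] this[of "[0, 2]"] this[of "[1, 2]"]
  show "edge r 1 2 = edge s 1 2" "edge r 1 3 = edge s 1 3" "edge r 2 3 = edge s 2 3"
    unfolding face_simps by (simp_all add: subsimplex_subsimplex eval_nat_numeral)
qed

lemma edges_tet4:
  "edge tet4 0 1 = central_edge" "edge tet4 0 2 = edge s 0 1" "edge tet4 0 3 = edge s 0 2"
  "edge tet4 1 2 = edge r 0 1" "edge tet4 1 3 = edge r 0 2" "edge tet4 2 3 = edge s 1 2"
  unfolding tet4_def central_edge_def
  by (simp_all add: subsimplex_subsimplex subsimplex_bipyramid_0 subsimplex_bipyramid_1 agree eval_nat_numeral)

lemma edges_tet2: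
  "edge tet2 0 1 = central_edge" "edge tet2 0 2 = edge s 0 2" "edge tet2 0 3 = edge s 0 3"
  "edge tet2 1 2 = edge r 0 2" "edge tet2 1 3 = edge r 0 3" "edge tet2 2 3 = edge s 2 3"
  unfolding tet2_def central_edge_def
  by (simp_all add: subsimplex_subsimplex subsimplex_bipyramid_0 subsimplex_bipyramid_1 agree eval_nat_numeral)

lemma edges_tet3:
  "edge tet3 0 1 = central_edge" "edge tet3 0 2 = edge s 0 1" "edge tet3 0 3 = edge s 0 3"
  "edge tet3 1 2 = edge r 0 1" "edge tet3 1 3 = edge r 0 3" "edge tet3 2 3 = edge s 1 3"
  unfolding tet3_def central_edge_def
  by (simp_all add: subsimplex_subsimplex subsimplex_bipyramid_0 subsimplex_bipyramid_1 agree eval_nat_numeral)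

text \<open>The space is the disjoint union of the open cells. Hence an edge or triangle whose
  interior meets the interior of \<open>s\<close> cannot be an old cell; this is how new cells are
  told apart from old ones.\<close>

lemma interior_point_inj:
  assumes x: "x \<in> open_simplex 3" and n: "n \<in> {1, 2, 3}" "u \<in> cells n T" and y: "y \<in> open_simplex n"
    and eq: "s x = u y"
  shows "n = 3 \<and> u = s \<and> x = y"
proof -
  have "s x \<in> X"
    using image_T[OF s] x open_simplex_subset_ideal_simplex[of 3] by auto
  from ex1_cell[OF this] obtain q where q: "\<forall>z. (case z of (n, u, y) \<Rightarrow>
      n \<in> {1, 2, 3} \<and> u \<in> cells n T \<and> y \<in> open_simplex n \<and> u y = s x) \<longrightarrow> z = q"
    unfolding Ex1_def by (elim exE conjE) (rule that)
  have "(3, s, x) = q"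
    using x s by (intro q[rule_format]) (simp add: cells_3 extensional_T)
  moreover have "(n, u, y) = q"
    using n y eq by (intro q[rule_format]) simp
  ultimately have "(3, s, x) = (n, u, y)"
    by (rule trans[OF _ sym])
  then show ?thesis by simp
qed

text \<open>The new edge passes through the interior of \<open>s\<close>, on its way to the face \<open>[2,3,4]\<close>.\<close>

lemma central_edge_notin_cells: "central_edge \<notin> cells 1 T"
proof
  assume a: "central_edge \<in> cells 1 T"
  \<comment> \<open>The weight 1/4 of vertex 1 is traded for 2/3 * 1/4 = 1/6 at each of the vertices
    2, 3, 4 and a loss of 1/4 at vertex 0, which gives \<open>?y\<close>.\<close>
  let ?z = "\<lambda>i::nat. if i = 0 then 3 / 4 else if i = 1 then 1 / 4 else 0 :: real"
  let ?y = "\<lambda>i::nat. if i = 0 then 1 / 2 else if i < 4 then 1 / 6 else 0 :: real"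
  have z: "?z \<in> open_simplex 1" and y: "?y \<in> open_simplex 3"
    by (auto simp: open_simplex_def standard_simplex_def eval_nat_numeral)
  have "embed_simplex [0, 1] ?z = ?z"
    by (auto simp: embed_simplex_def fun_eq_iff)
  moreover have "bipyramid_chart 0 ?z = ?y"
    by (auto simp: bipyramid_chart_def fun_eq_iff)
  ultimately have "central_edge ?z = s ?y"
    using open_simplex_subset_ideal_simplex[of 1] z
    by (auto simp: central_edge_def subsimplex_eq_embed bipyramid_eq_chart)
  then show False
    using interior_point_inj[OF y _ a z] by simp
qed

text \<open>Vertex 0 outweighs vertex 1, so the image lies on the side of \<open>s\<close>. The
  point is the same for all three faces, so that their values can be compared.\<close>

definition "mid_face_point = (\<lambda>i::nat. if i = 0 then 1 / 2 else if i \<le> 2 then 1 / 4 else 0 :: real)"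

lemma mid_face_point: "mid_face_point \<in> open_simplex 2"
  by (auto simp: mid_face_point_def open_simplex_def standard_simplex_def numeral_2_eq_2)

text \<open>Spreading the weight 1/4 of vertex 1 gives each of the vertices 2, 3, 4 the weight 1/6,
  and \<open>v\<close> keeps its own 1/4 besides. The bound 1/5 separates 1/6 from 5/12 and so
  recovers \<open>v\<close>.\<close>

lemma mid_face_interior_point:
  assumes v: "v \<in> {2, 3, 4}"
  shows "\<exists>y\<in>open_simplex 3. mid_face v mid_face_point = s y \<and> (\<forall>w\<in>{2, 3, 4}. y (w - 1) > 1 / 5 \<longleftrightarrow> w = v)"
proof (intro bexI conjI)
  let ?x = "\<lambda>i::nat. if i = 0 then 1 / 2 else if i = 1 then 1 / 4 else if i = v then 1 / 4 else 0 :: real"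
  let ?y = "\<lambda>i::nat. if i = 0 then 1 / 4 else if i < 4 then 1 / 6 + (if i + 1 = v then 1 / 4 else 0) else 0 :: real"
  show y: "?y \<in> open_simplex 3"
    using v by (auto simp: open_simplex_def standard_simplex_def numeral_3_eq_3)
  have x: "embed_simplex [0, 1, v] mid_face_point = ?x"
    using v by (auto simp: embed_simplex_def mid_face_point_def fun_eq_iff)
  have chart: "bipyramid_chart 0 ?x = ?y"
    using v by (auto simp: bipyramid_chart_def fun_eq_iff)
  have "mid_face_point \<in> ideal_simplex 2"
    using open_simplex_subset_ideal_simplex[of 2] mid_face_point by auto
  moreover have l: "length [0, 1, v] - 1 = 2" by simp
  ultimately show "mid_face v mid_face_point = s ?y"
    unfolding mid_face_def subsimplex_eq_embed bipyramid_eq_chart restrict_apply x l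
    by (simp add: chart del: One_nat_def)
  show "\<forall>w\<in>{2, 3, 4}. ?y (w - 1) > 1 / 5 \<longleftrightarrow> w = v"
    using v by auto
qed

lemma mid_face_notin_cells: 
  assumes "v \<in> {2, 3, 4}"
  shows "mid_face v \<notin> cells 2 T"
proof
  assume a: "mid_face v \<in> cells 2 T"
  obtain y where y: "y \<in> open_simplex 3" "mid_face v mid_face_point = s y"
    using mid_face_interior_point[OF assms] by blast
  then show False
    using interior_point_inj[OF y(1) _ a mid_face_point] by simp
qed

lemma mid_face_inj: "inj_on mid_face {2, 3, 4}"
proof (rule inj_onI)
  fix v w :: nat assume v: "v \<in> {2, 3, 4}" and w: "w \<in> {2, 3, 4}" and eq: "mid_face v = mid_face w"
  obtain z x where zx: "z = mid_face_point" "x \<in> open_simplex 3" "mid_face v z = s x" "\<forall>u\<in>{2, 3, 4}. 1 / 5 < x (u - 1) \<longleftrightarrow> u = v"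
    using mid_face_interior_point[OF v] by blast
  obtain y where y: "y \<in> open_simplex 3" "mid_face w z = s y" "\<forall>u\<in>{2, 3, 4}. 1 / 5 < y (u - 1) \<longleftrightarrow> u = w"
    using mid_face_interior_point[OF w] zx(1) by blast
  have "s \<in> cells 3 T"
    using s by (simp add: cells_3 extensional_T)
  then have "x = y"
    using interior_point_inj[OF zx(2) _ _ y(1), of s] zx(3) y(2) eq by auto
  then show "v = w"
    using zx(4) y(3) v by blast
qed

text \<open>Faces are glued in pairs, and \<open>(s, 0)\<close>, \<open>(r, 0)\<close> already are
  the two sides of \<open>[2,3,4]\<close>. Hence its unknown enters no other tetrahedron and no
  other face of \<open>s\<close> or \<open>r\<close>.\<close>

lemma face_eq_face_0:
  assumes "t \<in> T" "k < 4" "face t k = face s 0"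
  shows "k = 0 \<and> (t = s \<or> t = r)"
proof -
  let ?P = "{(t, k). t \<in> T \<and> k < 4 \<and> face t k = face s 0}"
  have "face s 0 \<in> cells 2 T" using s by (simp only: face_in_cells zero_less_numeral)
  then have c: "card ?P = 2" by (rule card_face)
  then have "finite ?P" by (intro card_ge_0_finite) (simp only: zero_less_numeral)
  moreover have "{(s, 0), (r, 0)} \<subseteq> ?P" using s r face_0 by (simp del: remove1.simps)
  moreover have "card {(s, 0 :: nat), (r, 0)} = 2" using s_neq_r by simp
  ultimately have "{(s, 0), (r, 0)} = ?P"
    using c by (intro card_subset_eq) auto
  then have "(t, k) \<in> {(s, 0), (r, 0)}" using assms by simp
  then show ?thesis by auto
qed

lemma new_tets_notin: "tet4 \<notin> T" "tet2 \<notin> T" "tet3 \<notin> T"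
proof -
  have "t \<notin> T" if "face t 2 = mid_face v" "v \<in> {2, 3, 4}" for t v
    using face_in_cells[of t T 2] mid_face_notin_cells[OF that(2)] that(1) by auto
  then show "tet4 \<notin> T" "tet2 \<notin> T" "tet3 \<notin> T"
    using faces_tet4(3) faces_tet2(3) faces_tet3(3) by blast+
qed

lemma new_tets_distinct: "tet4 \<noteq> tet2" "tet4 \<noteq> tet3" "tet2 \<noteq> tet3"
  using inj_onD[OF mid_face_inj, of 3 4] inj_onD[OF mid_face_inj, of 3 2]
    faces_tet4(3) faces_tet2(3,4) faces_tet3(3,4)
  by (metis insertCI numeral_eq_iff semiring_norm(86,88))+

text \<open>Outer faces may coincide with each other or with faces of other tetrahedra, so the count
  is done with sets; the point is that \<open>face s 0\<close> really disappears.\<close>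

lemma cells_2_T': "cells 2 T' = cells 2 T - {face s 0} \<union> {mid_face 2, mid_face 3, mid_face 4}"
proof -
  define old where "old = (\<Union>t\<in>T - {s, r}. {face t 0, face t 1, face t 2, face t 3})"
  let ?outer = "{face s 1, face s 2, face s 3, face r 1, face r 2, face r 3}"
  have "cells 2 T = cells 2 (T - {s, r} \<union> {s, r})"
    using s r by (intro arg_cong[where f = "cells 2"]) auto
  also have "\<dots> = old \<union> ({face s 0, face s 1, face s 2, face s 3} \<union> {face r 0, face r 1, face r 2, face r 3})"
    unfolding cells_2 UN_Un UN_insert UN_empty Un_empty_right old_def ..
  finally have T: "cells 2 T = insert (face s 0) (old \<union> ?outer)"
    unfolding face_0 by blast
  have "face s 0 \<notin> ?outer"
    using face_eq_face_0[OF s, of 1] face_eq_face_0[OF s, of 2] face_eq_face_0[OF s, of 3]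
      face_eq_face_0[OF r, of 1] face_eq_face_0[OF r, of 2] face_eq_face_0[OF r, of 3]
    by (auto simp del: remove1.simps One_nat_def)
  moreover have ne: "face s 0 \<noteq> face t k" if "t \<in> T - {s, r}" "k < 4" for t k
    using face_eq_face_0[of t k] that by (metis Diff_iff insertCI)
  then have "face s 0 \<notin> old"
    by (simp only: old_def UN_iff insert_iff empty_iff) (use ne[of _ 0] ne[of _ 1] ne[of _ 2] ne[of _ 3] in fastforce)
  ultimately have "cells 2 T - {face s 0} = old \<union> ?outer"
    unfolding T by blast
  moreover have "cells 2 T' = old \<union> ({face tet4 0, face tet4 1, face tet4 2, face tet4 3}
      \<union> {face tet2 0, face tet2 1, face tet2 2, face tet2 3} \<union> {face tet3 0, face tet3 1, face tet3 2, face tet3 3})"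
    unfolding cells_2 T'_def UN_Un UN_insert UN_empty Un_empty_right old_def[symmetric] by blast
  ultimately show ?thesis
    unfolding faces_tet4 faces_tet2 faces_tet3 by blast
qed

text \<open>Every edge of the two old tetrahedra is an edge of a new one. The additional edge
  contributes the fourth factor \<open>c01\<close> to the prefactor.\<close>

lemma cells_1_T': "cells 1 T' = insert central_edge (cells 1 T)"
proof -
  let ?E = "\<lambda>t. {edge t 0 1, edge t 0 2, edge t 0 3, edge t 1 2, edge t 1 3, edge t 2 3}"
  let ?old = "\<Union>t\<in>T - {s, r}. ?E t"
  have "cells 1 T = cells 1 (T - {s, r} \<union> {s, r})"
    using s r by (intro arg_cong[where f = "cells 1"]) auto
  also have "\<dots> = ?old \<union> (?E s \<union> ?E r)"
    unfolding cells_1 UN_Un UN_insert UN_empty Un_empty_right ..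
  finally have "cells 1 T = ?old \<union> (?E s \<union> ?E r)" .
  moreover have "cells 1 T' = ?old \<union> (?E tet4 \<union> ?E tet2 \<union> ?E tet3)"
    unfolding cells_1 T'_def UN_Un UN_insert UN_empty Un_empty_right by blast
  ultimately show ?thesis
    unfolding edges_tet4 edges_tet2 edges_tet3 edges_face_0 by blast
qed

lemma finite_cells_1: "finite (cells 1 T)"
  unfolding cells_1 using finite_T by blast

end

section \<open>Invariance\<close>

text \<open>The twisted unknown of face \<open>i\<close> as a row vector. Equality of two such
  vectors means that the tetrahedra share the face with the same exponent.\<close>

definition face_vec :: "('a simplex_map \<Rightarrow> nat \<Rightarrow> int) \<Rightarrow> 'a simplex_map \<Rightarrow> nat \<Rightarrow> 'a simplex_map \<Rightarrow> complex fls" where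
  "face_vec \<tau> s i g = (if face s i = g then fls_X_intpow (\<tau> s i) else 0)"

lemma face_row_simps:
  "face_row c \<tau> s 0 = (\<lambda>g. fls_const (c (edge s 2 3)) * face_vec \<tau> s 1 g
      - fls_const (c (edge s 1 3)) * face_vec \<tau> s 2 g + fls_const (c (edge s 1 2)) * face_vec \<tau> s 3 g)"
  "face_row c \<tau> s 1 = (\<lambda>g. fls_const (c (edge s 2 3)) * face_vec \<tau> s 0 g
      - fls_const (c (edge s 0 3)) * face_vec \<tau> s 2 g + fls_const (c (edge s 0 2)) * face_vec \<tau> s 3 g)"
  "face_row c \<tau> s 2 = (\<lambda>g. fls_const (c (edge s 1 3)) * face_vec \<tau> s 0 g
      - fls_const (c (edge s 0 3)) * face_vec \<tau> s 1 g + fls_const (c (edge s 0 1)) * face_vec \<tau> s 3 g)"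
  "face_row c \<tau> s 3 = (\<lambda>g. fls_const (c (edge s 1 2)) * face_vec \<tau> s 0 g
      - fls_const (c (edge s 0 2)) * face_vec \<tau> s 1 g + fls_const (c (edge s 0 1)) * face_vec \<tau> s 2 g)"
proof -
  have *: "(\<Sum>i<4. F i) = F 0 + F 1 + F 2 + F (3 :: nat)" for F :: "nat \<Rightarrow> complex fls"
    by (simp add: eval_nat_numeral)
  have **: "face_row c \<tau> s k g = (\<Sum>i<4. fls_const (face_equation c s k ! i) * face_vec \<tau> s i g)" for k g
    by (simp only: face_row_def face_vec_def)
  show "face_row c \<tau> s 0 = (\<lambda>g. fls_const (c (edge s 2 3)) * face_vec \<tau> s 1 g
      - fls_const (c (edge s 1 3)) * face_vec \<tau> s 2 g + fls_const (c (edge s 1 2)) * face_vec \<tau> s 3 g)"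
   "face_row c \<tau> s 1 = (\<lambda>g. fls_const (c (edge s 2 3)) * face_vec \<tau> s 0 g
      - fls_const (c (edge s 0 3)) * face_vec \<tau> s 2 g + fls_const (c (edge s 0 2)) * face_vec \<tau> s 3 g)"
   "face_row c \<tau> s 2 = (\<lambda>g. fls_const (c (edge s 1 3)) * face_vec \<tau> s 0 g
      - fls_const (c (edge s 0 3)) * face_vec \<tau> s 1 g + fls_const (c (edge s 0 1)) * face_vec \<tau> s 3 g)"
   "face_row c \<tau> s 3 = (\<lambda>g. fls_const (c (edge s 1 2)) * face_vec \<tau> s 0 g
      - fls_const (c (edge s 0 2)) * face_vec \<tau> s 1 g + fls_const (c (edge s 0 1)) * face_vec \<tau> s 2 g)"
    by (rule ext, simp add: ** * face_equation_def)+
qed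

lemma face_row_eq_0:
  assumes "\<And>i. i < 4 \<Longrightarrow> face s i \<noteq> g"
  shows "face_row c \<tau> s k g = 0"
  unfolding face_row_def by (intro sum.neutral) (use assms in \<open>simp del: remove1.simps\<close>)

lemma face_row_cong:
  assumes "\<And>i. i < 4 \<Longrightarrow> \<tau> s i = \<tau>' s i"
  shows "face_row c \<tau> s = face_row c \<tau>' s"
  unfolding face_row_def by (intro ext sum.cong) (simp_all add: assms del: remove1.simps)

text \<open>Only indices with \<open>face s i = g\<close> contribute to the entry at
  \<open>g\<close>, so \<open>b\<close> may be evaluated at the column.\<close>

lemma face_row_regauge:
  assumes "\<And>i. i < 4 \<Longrightarrow> \<tau> s i = a + \<tau>' s i + b (face s i)"
  shows "face_row c \<tau> s k = (\<lambda>g. fls_X_intpow a * face_row c \<tau>' s k g * fls_X_intpow (b g))"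
proof
  fix g
  have "fls_const (face_equation c s k ! i) * (if face s i = g then fls_X_intpow (\<tau> s i) else 0)
      = fls_X_intpow a * (fls_const (face_equation c s k ! i) * (if face s i = g then fls_X_intpow (\<tau>' s i) else 0))
        * fls_X_intpow (b g)" if "i < 4" for i
  proof (cases "face s i = g")
    case True
    have *: "(fls_X_intpow (a + \<tau>' s i + b g) :: complex fls) = fls_X_intpow a * fls_X_intpow (\<tau>' s i) * fls_X_intpow (b g)"
      by (simp only: fls_X_intpow_times_fls_X_intpow)
    then show ?thesis
      unfolding if_P[OF True] assms[OF that] True * by (simp only: if_True simp_thms ac_simps)
  qed simp
  then show "face_row c \<tau> s k g = fls_X_intpow a * face_row c \<tau>' s k g * fls_X_intpow (b g)"
    unfolding face_row_def sum_distrib_left sum_distrib_right by (intro sum.cong) simp_all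
qed

lemma det_twisted_face_matrix:
  "Determinant.det (twisted_face_matrix act c L rs fs)
    = row_det fs (map (\<lambda>(s, k). face_row c (twist act L) s k) rs)"
proof -
  have "twisted_face_matrix act c L rs fs = mat (length rs) (length fs)
      (\<lambda>(a, b). (map (\<lambda>(s, k). face_row c (twist act L) s k) rs ! a) (fs ! b))"
    unfolding twisted_face_matrix_def face_row_def
    by (intro cong_mat refl) (auto simp: case_prod_beta intro!: sum.cong)
  then show ?thesis by (simp add: row_det_def)
qed

lemma mset_edge_rows:
  assumes "distinct rs" "set rs = {(s, k). s \<in> T \<and> k < 4 \<and> k \<noteq> fst (E s) \<and> k \<noteq> snd (E s)}"
    and "distinct ss" "set ss = T"
  shows "mset (map (\<lambda>(s, k). face_row c \<tau> s k) rs) = mset (concat (map (\<lambda>s. edge_rows c \<tau> (E s) s) ss))"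
proof -
  define P where "P s = filter (\<lambda>k. k \<noteq> fst (E s) \<and> k \<noteq> snd (E s)) [0, 1, 2, 3]" for s
  have dP: "distinct (P s)" for s
    unfolding P_def by (rule distinct_filter) simp
  have sP: "set (P s) = {k. k < 4 \<and> k \<noteq> fst (E s) \<and> k \<noteq> snd (E s)}" for s
    unfolding P_def set_filter by (intro Collect_cong) (auto simp: less_4_iff)
  let ?rs = "concat (map (\<lambda>s. map (Pair s) (P s)) ss)"
  have "distinct ?rs"
    using assms(3) dP by (induction ss) (auto simp: distinct_map inj_on_def)
  moreover have "set ?rs = set rs"
    unfolding assms(2) using assms(4) sP by auto
  ultimately have "mset rs = mset ?rs"
    using assms(1) by (simp only: set_eq_iff_mset_eq_distinct)
  then have "mset (map (\<lambda>(s, k). face_row c \<tau> s k) rs) = mset (map (\<lambda>(s, k). face_row c \<tau> s k) ?rs)"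
    by (simp only: mset_map)
  also have "map (\<lambda>(s, k). face_row c \<tau> s k) ?rs = concat (map (\<lambda>s. edge_rows c \<tau> (E s) s) ss)"
    by (simp only: map_concat map_map o_def case_prod_conv edge_rows_def P_def)
  finally show ?thesis .
qed

lemma ptolemy_nonzero:
  assumes "ptolemy_assignment T c" "t \<in> T" "i < j" "j < 4"
  shows "c (edge t i j) \<noteq> 0"
proof -
  have "i < 4" "i \<noteq> j" using assms(3,4) by simp_all
  then show ?thesis
    using conjunct1[OF assms(1)[unfolded ptolemy_assignment_def]] assms(2,4) by blast
qed

lemma ptolemy_relation:
  assumes "ptolemy_assignment T c" "t \<in> T"
  shows "c (edge t 0 1) * c (edge t 2 3) - c (edge t 0 2) * c (edge t 1 3)
        + c (edge t 0 3) * c (edge t 1 2) = 0"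
  using conjunct2[OF assms(1)[unfolded ptolemy_assignment_def]] assms(2) by (rule bspec)

section \<open>Independence of the choices\<close>

context cyclic_cover
begin

lemma cell_lifts_face:
  assumes "cell_lifts Mt p T L" "f \<in> cells 2 T"
  shows "is_lift Mt p 2 f (L f)"
  using assms unfolding cell_lifts_def is_lift_def by blast

lemma cell_lifts_tet:
  assumes "cell_lifts Mt p T L" "\<And>t. t \<in> T \<Longrightarrow> t \<in> extensional (ideal_simplex 3)" "t \<in> T"
  shows "is_lift Mt p 3 t (L t)"
  using assms(1,3) cells_3[OF assms(2)] unfolding cell_lifts_def is_lift_def by blast

text \<open>Normal form with freely chosen edges, orders and lifts. The lifts \<open>g\<close> and
  \<open>h\<close> are unrelated functions because an exponent compares one lifted tetrahedron with
  one lifted face; lifts of edges do not enter it.\<close>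

lemma one_loop_polynomial_rows:
  assumes ext: "\<And>t. t \<in> T \<Longrightarrow> t \<in> extensional (ideal_simplex 3)"
    and pt: "ptolemy_assignment T c"
    and ch: "face_matrix_choices Mt p T L E rs fs"
    and g: "\<And>t. t \<in> T \<Longrightarrow> is_lift Mt p 3 t (g t)" and h: "\<And>f. f \<in> cells 2 T \<Longrightarrow> is_lift Mt p 2 f (h f)"
    and ss: "distinct ss" "set ss = T" and gs: "distinct gs" "set gs = cells 2 T"
    and E': "\<And>t. t \<in> T \<Longrightarrow> fst (E' t) < snd (E' t) \<and> snd (E' t) < 4"
  shows "one_loop_polynomial act T c L E rs fs \<doteq>
    fls_const (1 / (\<Prod>e\<in>cells 1 T. c e)) *
      (fls_const (\<Prod>t\<leftarrow>ss. 1 / c (edge t (fst (E' t)) (snd (E' t)))) *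
       row_det gs (concat (map (\<lambda>t. edge_rows c (\<lambda>t i. gain (face (g t) i) (h (face t i))) (E' t) t) ss)))"
proof -
  define \<tau> where "\<tau> t i = gain (face (g t) i) (h (face t i))" for t i
  have L: "cell_lifts Mt p T L" and E: "\<And>t. t \<in> T \<Longrightarrow> fst (E t) < snd (E t) \<and> snd (E t) < 4"
    and rs: "distinct rs" "set rs = {(s, k). s \<in> T \<and> k < 4 \<and> k \<noteq> fst (E s) \<and> k \<noteq> snd (E s)}"
    and fs: "distinct fs" "set fs = cells 2 T"
    using ch unfolding face_matrix_choices_def by blast+
  have "\<exists>a b. \<forall>t\<in>T. \<forall>i<4. gain (face (L t) i) (L (face t i)) = a t + \<tau> t i + b (face t i)"
    unfolding \<tau>_def
    by (intro gain_change_lifts cell_lifts_tet[OF L ext] cell_lifts_face[OF L] g h face_in_cells)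
  then obtain a b where ab: "\<And>t i. t \<in> T \<Longrightarrow> i < 4 \<Longrightarrow> twist act L t i = a t + \<tau> t i + b (face t i)"
    unfolding twist_eq_gain by blast
  have nz: "c (edge t i j) \<noteq> 0" if "t \<in> set ss" "i < j" "j < 4" for t i j
    using ptolemy_nonzero[OF pt _ that(2,3)] that(1) ss(2) by blast
  have pl: "c (edge t 0 1) * c (edge t 2 3) - c (edge t 0 2) * c (edge t 1 3)
        + c (edge t 0 3) * c (edge t 1 2) = 0" if "t \<in> set ss" for t
    using ptolemy_relation[OF pt] that ss(2) by blast
  let ?V = "\<lambda>E. concat (map (\<lambda>t. edge_rows c \<tau> (E t) t) ss)"
  let ?P = "\<lambda>E. \<Prod>t\<leftarrow>ss. 1 / c (edge t (fst (E t)) (snd (E t)))"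
  have "row_det fs (map (\<lambda>(s, k). face_row c (twist act L) s k) rs)
      = row_det fs (map (\<lambda>r f. fls_X_intpow (a (fst r)) * face_row c \<tau> (fst r) (snd r) f * fls_X_intpow (b f)) rs)"
  proof (intro arg_cong[where f = "row_det fs"] map_cong refl)
    fix r assume "r \<in> set rs"
    then have "fst r \<in> T" using rs(2) by auto
    then show "(case r of (s, k) \<Rightarrow> face_row c (twist act L) s k)
       = (\<lambda>f. fls_X_intpow (a (fst r)) * face_row c \<tau> (fst r) (snd r) f * fls_X_intpow (b f))"
      unfolding case_prod_beta by (intro face_row_regauge ab)
  qed
  also have "\<dots> \<doteq> row_det fs (map (\<lambda>r. face_row c \<tau> (fst r) (snd r)) rs)"
    by (rule row_det_scale_intpow)
  also have "\<dots> = row_det fs (map (\<lambda>(s, k). face_row c \<tau> s k) rs)"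
    by (simp only: case_prod_beta')
  also have "\<dots> \<doteq> row_det fs (?V E)"
    by (intro row_det_mset_rows mset_edge_rows[OF rs ss])
  also have "\<dots> \<doteq> row_det gs (?V E)"
    using fs gs by (intro row_det_mset_columns) (simp flip: set_eq_iff_mset_eq_distinct)
  finally have 1: "row_det fs (map (\<lambda>(s, k). face_row c (twist act L) s k) rs) \<doteq> row_det gs (?V E)" .
  \<comment> \<open>Both \<open>E\<close> and \<open>E'\<close> are compared with the constant
    choice \<open>[0,1]\<close>.\<close>
  have base: "fls_const (?P E) * row_det gs (?V E)
      \<doteq> fls_const (\<Prod>t\<leftarrow>ss. 1 / c (edge t 0 1)) * row_det gs (?V (\<lambda>_. (0, 1)))"
    if "\<And>t. t \<in> T \<Longrightarrow> fst (E t) < snd (E t) \<and> snd (E t) < 4" for E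
    using concat_edge_rows_change[where U = "[]" and \<tau> = \<tau> and ss = ss and E = E and c = c and fs = gs, OF nz pl]
      that unfolding append_Nil ss(2) by blast
  have P: "(\<Prod>t\<in>T. 1 / c (edge t (fst (E t)) (snd (E t)))) = ?P E"
    unfolding ss(2)[symmetric] by (rule prod.distinct_set_conv_list[OF ss(1)])
  have "one_loop_polynomial act T c L E rs fs = fls_const (1 / (\<Prod>e\<in>cells 1 T. c e)) *
      (fls_const (?P E) * row_det fs (map (\<lambda>(s, k). face_row c (twist act L) s k) rs))"
    unfolding one_loop_polynomial_def det_twisted_face_matrix P by (simp flip: mult.assoc)
  also have "\<dots> \<doteq> fls_const (1 / (\<Prod>e\<in>cells 1 T. c e)) * (fls_const (?P E) * row_det gs (?V E))"
    by (intro eq_up_to_unit_mult_left 1)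
  also have "\<dots> \<doteq> fls_const (1 / (\<Prod>e\<in>cells 1 T. c e)) *
      (fls_const (\<Prod>t\<leftarrow>ss. 1 / c (edge t 0 1)) * row_det gs (?V (\<lambda>_. (0, 1))))"
    by (intro eq_up_to_unit_mult_left base E)
  also have "\<dots> \<doteq> fls_const (1 / (\<Prod>e\<in>cells 1 T. c e)) * (fls_const (?P E') * row_det gs (?V E'))"
    by (intro eq_up_to_unit_mult_left eq_up_to_unit_sym[OF base] E')
  finally show ?thesis
    unfolding \<tau>_def .
qed

end

section \<open>Comparison of the two polynomials\<close>

locale pachner_cover = cyclic_cover M Mt p act + pachner X T s r
  for M :: "'a::topological_space set" and Mt :: "'b::topological_space set" and p act
    and X :: "'a set" and T s r
begin

lemma new_faces_neq:
  assumes "f \<in> cells 2 T" "v \<in> {2, 3, 4}"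
  shows "f \<noteq> mid_face v"
  using mid_face_notin_cells assms by blast

lemma outer_face:
  assumes "t \<in> T" "0 < k" "k < 4"
  shows "face t k \<in> cells 2 T - {face s 0}"
  using assms face_eq_face_0[OF assms(1,3)] face_in_cells[OF assms(1,3)] by blast

lemma one_loop_polynomial_pachner:
  assumes pt: "ptolemy_assignment T c" and pt': "ptolemy_assignment T' c"
    and ch: "face_matrix_choices Mt p T L E rs fs" and ch': "face_matrix_choices Mt p T' L' E' rs' fs'"
  shows "one_loop_polynomial act T c L E rs fs \<doteq> one_loop_polynomial act T' c L' E' rs' fs'"
proof -
  have L: "cell_lifts Mt p T L"
    using ch unfolding face_matrix_choices_def by (rule conjunct1)
  note Lf = cell_lifts_face[OF L]
  have Lt: "is_lift Mt p 3 t (L t)" if "t \<in> T" for t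
    using cell_lifts_tet[OF L extensional_T that] .
  have "is_lift Mt p 2 (face s 0) (face (L s) 0)" "is_lift Mt p 2 (face s 0) (face (L r) 0)"
    using is_lift_face[OF Lt[OF s], of 0] is_lift_face[OF Lt[OF r], of 0] by (simp_all only: face_0 zero_less_numeral)
  then obtain k where k: "\<And>x. x \<in> ideal_simplex 2 \<Longrightarrow> face (L s) 0 x = act k (face (L r) 0 x)"
    using lift_eq_act[OF zero_less_numeral] by blast
  \<comment> \<open>Shifted by \<open>k\<close>, the lift of \<open>r\<close> becomes adjacent to
    the lift of \<open>s\<close> across \<open>[2,3,4]\<close>.\<close>
  define lr where "lr = (\<lambda>x. act k (L r x))"
  have lr: "is_lift Mt p 3 r lr"
    unfolding lr_def by (rule is_lift_act[OF Lt[OF r]])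
  have lr_face: "face (L s) 0 = face lr 0"
  proof
    fix x
    have "length (remove1 0 [0, 1, 2, 3 :: nat]) - 1 = 2" by simp
    note * = subsimplex_eq_embed[of _ "remove1 0 [0, 1, 2, 3]", unfolded this]
    show "face (L s) 0 x = face lr 0 x"
    proof (cases "x \<in> ideal_simplex 2")
      case True
      then show ?thesis unfolding k[OF True] unfolding * lr_def by (simp only: restrict_apply if_True)
    next
      case False
      then show ?thesis unfolding * by (simp only: restrict_apply if_False)
    qed
  qed
  have lift_agree: "agree_on_face_0 (L s) lr"
    by (rule agree_on_face_0I) (simp only: lr_face)
  define LB where "LB = bipyramid (L s) lr"
  have LB: "is_lift Mt p 4 B LB"
    unfolding LB_def by (rule is_lift_bipyramid[OF Lt[OF s] lr lift_agree])
  \<comment> \<open>All four maps agree with \<open>L\<close> on the cells that survive. The other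
    cells are lifted inside one lifted bipyramid, so that inner faces get exponent 0 and each outer
    face has the same exponent before and after the move.\<close>
  define g where "g = L(r := lr)"
  define h where "h = L(face s 0 := face (L s) 0)"
  define g' where "g' = L(tet4 := subsimplex LB [0, 1, 2, 3], tet2 := subsimplex LB [0, 1, 3, 4],
      tet3 := subsimplex LB [0, 1, 2, 4])"
  define h' where "h' = L(mid_face 2 := subsimplex LB [0, 1, 2], mid_face 3 := subsimplex LB [0, 1, 3],
      mid_face 4 := subsimplex LB [0, 1, 4])"
  have mid_neq: "mid_face 2 \<noteq> mid_face 3" "mid_face 2 \<noteq> mid_face 4" "mid_face 3 \<noteq> mid_face 4"
    using inj_onD[OF mid_face_inj, of 2 3] inj_onD[OF mid_face_inj, of 2 4] inj_onD[OF mid_face_inj, of 3 4]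
    by auto
  have g_eq: "g s = L s" "g r = lr"
    using s_neq_r by (simp_all add: g_def)
  have g_old: "g t = L t" "g' t = L t" if "t \<in> T - {s, r}" for t
    using that new_tets_notin by (auto simp: g_def g'_def)
  have g'_new: "g' tet4 = subsimplex LB [0, 1, 2, 3]" "g' tet2 = subsimplex LB [0, 1, 3, 4]"
      "g' tet3 = subsimplex LB [0, 1, 2, 4]"
    using new_tets_distinct by (simp_all add: g'_def)
  have h_old: "h f = L f" "h' f = L f" if "f \<in> cells 2 T - {face s 0}" for f
    using that new_faces_neq[of f 2] new_faces_neq[of f 3] new_faces_neq[of f 4]
    by (auto simp: h_def h'_def)
  have h_face_0: "h (face s 0) = face (L s) 0"
    by (simp only: h_def fun_upd_same)
  have h'_new: "h' (mid_face 2) = subsimplex LB [0, 1, 2]" "h' (mid_face 3) = subsimplex LB [0, 1, 3]"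
      "h' (mid_face 4) = subsimplex LB [0, 1, 4]"
    using mid_neq by (simp_all add: h'_def)
  have lift_g: "is_lift Mt p 3 t (g t)" if "t \<in> T" for t
    using Lt[OF that] lr by (cases "t = r") (simp_all add: g_def)
  have lift_h: "is_lift Mt p 2 f (h f)" if "f \<in> cells 2 T" for f
    using Lf[OF that] is_lift_face[OF Lt[OF s], of 0]
    by (cases "f = face s 0") (simp_all only: h_def fun_upd_same fun_upd_other zero_less_numeral not_False_eq_True)
  have LB3: "is_lift Mt p 3 (subsimplex B [0, 1, v, w]) (subsimplex LB [0, 1, v, w])"
    if "v < w" "1 < v" "w < 5" for v w
    using is_lift_subsimplex[OF LB, of "[0, 1, v, w]"] that by (auto simp: numeral_3_eq_3)
  have LB2: "is_lift Mt p 2 (subsimplex B [0, 1, v]) (subsimplex LB [0, 1, v])"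
    if "1 < v" "v < 5" for v
    using is_lift_subsimplex[OF LB, of "[0, 1, v]"] that by (auto simp: numeral_2_eq_2)
  have lift_g': "is_lift Mt p 3 t (g' t)" if "t \<in> T'" for t
  proof -
    consider "t \<in> T - {s, r}" | "t = tet4" | "t = tet2" | "t = tet3"
      using \<open>t \<in> T'\<close> unfolding T'_def by blast
    then show ?thesis
    proof cases
      case 1
      then show ?thesis using Lt g_old(2)[OF 1] by simp
    next
      case 2
      show ?thesis unfolding 2 g'_new unfolding tet4_def by (rule LB3) simp_all
    next
      case 3
      show ?thesis unfolding 3 g'_new unfolding tet2_def by (rule LB3) simp_all
    next
      case 4
      show ?thesis unfolding 4 g'_new unfolding tet3_def by (rule LB3) simp_all
    qed
  qed
  have lift_h': "is_lift Mt p 2 f (h' f)" if "f \<in> cells 2 T'" for f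
  proof -
    consider "f \<in> cells 2 T - {face s 0}" | "f = mid_face 2" | "f = mid_face 3" | "f = mid_face 4"
      using \<open>f \<in> cells 2 T'\<close>[unfolded cells_2_T' Un_iff insert_iff empty_iff] by argo
    then show ?thesis
    proof cases
      case 1
      then show ?thesis using Lf h_old(2)[OF 1] by simp
    next
      case 2
      show ?thesis unfolding 2 h'_new unfolding mid_face_def by (rule LB2) simp_all
    next
      case 3
      show ?thesis unfolding 3 h'_new unfolding mid_face_def by (rule LB2) simp_all
    next
      case 4
      show ?thesis unfolding 4 h'_new unfolding mid_face_def by (rule LB2) simp_all
    qed
  qed
  define \<tau> where "\<tau> t i = gain (face (g t) i) (h (face t i))" for t i
  define \<tau>' where "\<tau>' t i = gain (face (g' t) i) (h' (face t i))" for t i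

  obtain us where us: "distinct us" "set us = T - {s, r}"
    using finite_distinct_list[of "T - {s, r}"] finite_T by auto
  have "finite (cells 2 T)"
    unfolding cells_2 using finite_T by blast
  then obtain G where G: "distinct G" "set G = cells 2 T - {face s 0}"
    using finite_distinct_list[of "cells 2 T - {face s 0}"] by auto
  define W where "W = concat (map (\<lambda>t. edge_rows c \<tau> (0, 1) t) us)"
  define W' where "W' = concat (map (\<lambda>t. edge_rows c \<tau>' (0, 1) t) us)"
  define P where "P = (\<Prod>t\<leftarrow>us. 1 / c (edge t 0 1))"
  \<comment> \<open>In the numbering of \<open>s\<close> and \<open>r\<close> the edge
    \<open>[3,4]\<close> is \<open>(2, 3)\<close>, so their equations 0 and 1 are kept.\<close>
  let ?E = "\<lambda>t. if t = s \<or> t = r then (2, 3) else (0, 1 :: nat) :: nat \<times> nat"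
  have us_neq: "t \<noteq> s" "t \<noteq> r" if "t \<in> set us" for t
    using that us by auto
  have "one_loop_polynomial act T c L E rs fs \<doteq> fls_const (1 / (\<Prod>e\<in>cells 1 T. c e)) *
      (fls_const (\<Prod>t\<leftarrow>s # r # us. 1 / c (edge t (fst (?E t)) (snd (?E t)))) *
       row_det (face s 0 # G) (concat (map (\<lambda>t. edge_rows c \<tau> (?E t) t) (s # r # us))))"
    unfolding \<tau>_def
  proof (rule one_loop_polynomial_rows[OF extensional_T pt ch lift_g lift_h])
    show "distinct (s # r # us)" "set (s # r # us) = T"
      using us s r s_neq_r by auto
    show "distinct (face s 0 # G)" "set (face s 0 # G) = cells 2 T"
      using G face_in_cells[OF s, of 0] by (auto simp del: remove1.simps)
  qed auto
  moreover have "(\<Prod>t\<leftarrow>s # r # us. 1 / c (edge t (fst (?E t)) (snd (?E t))))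
      = 1 / c (edge s 2 3) * (1 / c (edge r 2 3) * P)"
    unfolding P_def using us_neq by (auto intro!: arg_cong[where f = prod_list])
  moreover have "concat (map (\<lambda>t. edge_rows c \<tau> (?E t) t) (s # r # us))
      = [face_row c \<tau> s 0, face_row c \<tau> s 1, face_row c \<tau> r 0, face_row c \<tau> r 1] @ W"
    unfolding W_def using us_neq by (auto simp: edge_rows_def intro!: arg_cong[where f = concat])
  ultimately have left: "one_loop_polynomial act T c L E rs fs \<doteq> fls_const (1 / (\<Prod>e\<in>cells 1 T. c e)) *
      (fls_const (1 / c (edge s 2 3) * (1 / c (edge r 2 3) * P)) * row_det (face s 0 # G)
        ([face_row c \<tau> s 0, face_row c \<tau> s 1, face_row c \<tau> r 0, face_row c \<tau> r 1] @ W))"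
    by (simp only:)

  have "one_loop_polynomial act T' c L' E' rs' fs' \<doteq> fls_const (1 / (\<Prod>e\<in>cells 1 T'. c e)) *
      (fls_const (\<Prod>t\<leftarrow>tet4 # tet2 # tet3 # us. 1 / c (edge t (fst (0, 1 :: nat)) (snd (0 :: nat, 1)))) *
       row_det ([mid_face 2, mid_face 3, mid_face 4] @ G)
        (concat (map (\<lambda>t. edge_rows c \<tau>' (0, 1) t) (tet4 # tet2 # tet3 # us))))"
    unfolding \<tau>'_def
  proof (rule one_loop_polynomial_rows[OF extensional_T' pt' ch' lift_g' lift_h'])
    show "distinct (tet4 # tet2 # tet3 # us)" "set (tet4 # tet2 # tet3 # us) = T'"
      using us new_tets_distinct new_tets_notin by (auto simp: T'_def)
    show "distinct ([mid_face 2, mid_face 3, mid_face 4] @ G)"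
      "set ([mid_face 2, mid_face 3, mid_face 4] @ G) = cells 2 T'"
      using G mid_neq mid_face_notin_cells by (auto simp: cells_2_T' simp del: remove1.simps)
  qed auto
  moreover have "(\<Prod>t\<leftarrow>tet4 # tet2 # tet3 # us. 1 / c (edge t (fst (0, 1 :: nat)) (snd (0 :: nat, 1))))
      = 1 / c central_edge * (1 / c central_edge * (1 / c central_edge * P))"
    by (simp only: P_def list.map prod_list.Cons fst_conv snd_conv edges_tet4(1) edges_tet2(1) edges_tet3(1))
  moreover have "concat (map (\<lambda>t. edge_rows c \<tau>' (0, 1) t) (tet4 # tet2 # tet3 # us))
      = [face_row c \<tau>' tet4 2, face_row c \<tau>' tet4 3, face_row c \<tau>' tet2 2, face_row c \<tau>' tet2 3,
         face_row c \<tau>' tet3 2, face_row c \<tau>' tet3 3] @ W'"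
    unfolding W'_def by (simp only: list.map concat.simps append.simps
      edge_rows_0_1[of _ _ tet4] edge_rows_0_1[of _ _ tet2] edge_rows_0_1[of _ _ tet3])
  moreover have "(\<Prod>e\<in>cells 1 T'. c e) = c central_edge * (\<Prod>e\<in>cells 1 T. c e)"
    unfolding cells_1_T' using finite_cells_1 central_edge_notin_cells by simp
  ultimately have right: "one_loop_polynomial act T' c L' E' rs' fs'
      \<doteq> fls_const (1 / (c central_edge * (\<Prod>e\<in>cells 1 T. c e))) *
      (fls_const (1 / c central_edge * (1 / c central_edge * (1 / c central_edge * P))) *
       row_det ([mid_face 2, mid_face 3, mid_face 4] @ G)
        ([face_row c \<tau>' tet4 2, face_row c \<tau>' tet4 3, face_row c \<tau>' tet2 2, face_row c \<tau>' tet2 3,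
         face_row c \<tau>' tet3 2, face_row c \<tau>' tet3 3] @ W'))"
    by (simp only:)

  \<comment> \<open>Tetrahedra outside the bipyramid have only surviving faces, on which the two
    systems of lifts coincide.\<close>
  have W': "W' = W"
  proof -
    have "edge_rows c \<tau>' (0, 1) t = edge_rows c \<tau> (0, 1) t" if "t \<in> set us" for t
    proof -
      have t: "t \<in> T - {s, r}" using that us by simp
      have "\<tau>' t i = \<tau> t i" if "i < 4" for i
      proof -
        have "face t i \<in> cells 2 T - {face s 0}"
          using t that face_eq_face_0[of t i] face_in_cells[of t T i] by blast
        then show ?thesis
          by (simp only: \<tau>_def \<tau>'_def g_old[OF t] h_old)
      qed
      then have "face_row c \<tau>' t = face_row c \<tau> t"
        by (rule face_row_cong)
      then show ?thesis by (simp only: edge_rows_def)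
    qed
    then have "map (\<lambda>t. edge_rows c \<tau>' (0, 1) t) us = map (\<lambda>t. edge_rows c \<tau> (0, 1) t) us"
      by (intro map_cong refl)
    then show ?thesis by (simp only: W_def W'_def)
  qed

  have tau_outer: "\<tau>' t' i = \<tau> t k" 
    if "t \<in> T" "0 < k" "k < 4" "face t' i = face t k" "face (g' t') i = face (g t) k" for t t' i k
    unfolding \<tau>_def \<tau>'_def that(4,5) using h_old[OF outer_face[OF that(1-3)]] by (simp only:)
  have vec_outer: "face_vec \<tau>' t' i = face_vec \<tau> t k" 
    if "t \<in> T" "0 < k" "k < 4" "face t' i = face t k" "face (g' t') i = face (g t) k" for t t' i k
    unfolding face_vec_def tau_outer[OF that] that(4) ..
  have g'_faces:
    "face (g' tet4) 0 = face (g r) 3" "face (g' tet4) 1 = face (g s) 3"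
    "face (g' tet4) 2 = h' (mid_face 3)" "face (g' tet4) 3 = h' (mid_face 2)"
    "face (g' tet2) 0 = face (g r) 1" "face (g' tet2) 1 = face (g s) 1"
    "face (g' tet2) 2 = h' (mid_face 4)" "face (g' tet2) 3 = h' (mid_face 3)"
    "face (g' tet3) 0 = face (g r) 2" "face (g' tet3) 1 = face (g s) 2"
    "face (g' tet3) 2 = h' (mid_face 4)" "face (g' tet3) 3 = h' (mid_face 2)"
    unfolding g'_new g_eq h'_new LB_def
    by (fact faces_bipyramid_0123[OF lift_agree] faces_bipyramid_0134[OF lift_agree] faces_bipyramid_0124[OF lift_agree])+
  have outer:
    "face_vec \<tau>' tet4 0 = face_vec \<tau> r 3" "face_vec \<tau>' tet4 1 = face_vec \<tau> s 3"
    "face_vec \<tau>' tet2 0 = face_vec \<tau> r 1" "face_vec \<tau>' tet2 1 = face_vec \<tau> s 1"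
    "face_vec \<tau>' tet3 0 = face_vec \<tau> r 2" "face_vec \<tau>' tet3 1 = face_vec \<tau> s 2"
    by (rule vec_outer, rule s r, simp, simp, rule faces_tet4 faces_tet2 faces_tet3, rule g'_faces)+
  define u where "u v f = (if f = mid_face v then 1 else 0 :: complex fls)" for v f
  \<comment> \<open>A new face is lifted as a face of the lifted new tetrahedra, so its exponent is
    0 and its vector is a plain unit vector.\<close>
  have vec_mid: "face_vec \<tau>' t i = u v" if "v \<in> {2, 3, 4}" "face t i = mid_face v" "face (g' t) i = h' (mid_face v)" for t i v
  proof -
    have "mid_face v \<in> cells 2 T'" using that(1) by (auto simp: cells_2_T')
    then have "gain (h' (mid_face v)) (h' (mid_face v)) = 0"
      by (rule gain_self[OF lift_h'])
    then have "\<tau>' t i = 0" unfolding \<tau>'_def that by (simp only:)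
    then show ?thesis unfolding face_vec_def u_def that(2) by (auto simp: fun_eq_iff)
  qed
  have mid:
    "face_vec \<tau>' tet4 2 = u 3" "face_vec \<tau>' tet4 3 = u 2" "face_vec \<tau>' tet2 2 = u 4" "face_vec \<tau>' tet2 3 = u 3"
    "face_vec \<tau>' tet3 2 = u 4" "face_vec \<tau>' tet3 3 = u 2"
    by (rule vec_mid, simp, rule faces_tet4 faces_tet2 faces_tet3, rule g'_faces)+
  have gain_0: "gain (face (L s) 0) (face (L s) 0) = 0"
    by (rule gain_self[OF is_lift_face[OF Lt[OF s]]]) simp
  have tau_0: "\<tau> s 0 = 0" "\<tau> r 0 = 0"
    unfolding \<tau>_def face_0[symmetric] h_face_0 g_eq lr_face[symmetric] by (fact gain_0)+
  \<comment> \<open>Adjacency of the lifts pays off: the unknown of \<open>[2,3,4]\<close> is the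
    same vector in \<open>s\<close> and \<open>r\<close>, without a relative power of
    \<open>t\<close>, and can cancel.\<close>
  have vec_0: "face_vec \<tau> r 0 = face_vec \<tau> s 0"
    unfolding face_vec_def tau_0 face_0 ..

  let ?c = "\<lambda>t i j. fls_const (c (edge t i j))"
  have tets: "tet4 \<in> T'" "tet2 \<in> T'" "tet3 \<in> T'" by (auto simp: T'_def)
  have c_nz: "c central_edge \<noteq> 0" "c (edge s 0 3) \<noteq> 0" "c (edge s 2 3) \<noteq> 0"
    using ptolemy_nonzero[OF pt' tets(1), of 0 1] ptolemy_nonzero[OF pt s, of 0 3] ptolemy_nonzero[OF pt s, of 2 3]
    unfolding edges_tet4(1) by simp_all
  have const: "fls_const x * fls_const y - fls_const z * fls_const w + fls_const a * fls_const b = 0"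
    if "x * y - z * w + a * b = 0" for x y z w a b :: complex
    using arg_cong[OF that, of fls_const] by (simp add: fls_plus_const[symmetric] fls_minus_const[symmetric])
  have "1 / (?c s 2 3)\<^sup>2 * row_det (face s 0 # G)
        ([face_row c \<tau> s 0, face_row c \<tau> s 1, face_row c \<tau> r 0, face_row c \<tau> r 1] @ W)
     \<doteq> 1 / (fls_const (c central_edge)) ^ 4 * row_det ([mid_face 2, mid_face 3, mid_face 4] @ G)
        ([face_row c \<tau>' tet4 2, face_row c \<tau>' tet4 3, face_row c \<tau>' tet2 2, face_row c \<tau>' tet2 3,
         face_row c \<tau>' tet3 2, face_row c \<tau>' tet3 3] @ W)"
    unfolding face_row_simps outer mid vec_0 edges_tet4 edges_tet2 edges_tet3 edges_face_0
  proof (rule pachner_row_det)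
    show "fls_const (c central_edge) \<noteq> 0" "?c s 0 3 \<noteq> 0" "?c s 2 3 \<noteq> 0"
      using c_nz by simp_all
    show "?c s 0 1 * ?c s 2 3 - ?c s 0 2 * ?c s 1 3 + ?c s 0 3 * ?c s 1 2 = 0"
      by (rule const) (rule ptolemy_relation[OF pt s])
    show "?c r 0 1 * ?c s 2 3 - ?c r 0 2 * ?c s 1 3 + ?c r 0 3 * ?c s 1 2 = 0"
      using ptolemy_relation[OF pt r] unfolding edges_face_0 by (rule const)
    show "fls_const (c central_edge) * ?c s 2 3 - ?c s 0 2 * ?c r 0 3 + ?c s 0 3 * ?c r 0 2 = 0"
      using ptolemy_relation[OF pt' tets(2)] unfolding edges_tet2 by (rule const)
    show "face_vec \<tau> s 0 (face s 0) = 1"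
      unfolding face_vec_def tau_0 by simp
    show "u 2 (mid_face 2) = 1" "u 2 (mid_face 3) = 0" "u 2 (mid_face 4) = 0"
      "u 3 (mid_face 2) = 0" "u 3 (mid_face 3) = 1" "u 3 (mid_face 4) = 0"
      "u 4 (mid_face 2) = 0" "u 4 (mid_face 3) = 0" "u 4 (mid_face 4) = 1"
      using mid_neq by (auto simp: u_def)
    fix v n
    assume v: "v \<in> {face_vec \<tau> s 3, face_vec \<tau> s 2, face_vec \<tau> s 1, face_vec \<tau> r 3, face_vec \<tau> r 2, face_vec \<tau> r 1} \<union> set W"
      and n: "n \<in> {face s 0, mid_face 2, mid_face 3, mid_face 4}"
    have n': "n \<notin> cells 2 T - {face s 0}"
      using n mid_face_notin_cells by auto
    have "face_vec \<tau> t k n = 0" if "t \<in> T" "0 < k" "k < 4" for t k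
      using outer_face[OF that] n' unfolding face_vec_def by auto
    then have out: "v n = 0" if "v \<in> {face_vec \<tau> s 3, face_vec \<tau> s 2, face_vec \<tau> s 1, face_vec \<tau> r 3, face_vec \<tau> r 2, face_vec \<tau> r 1}"
      using that s r by auto
    have "v n = 0" if vW: "v \<in> set W"
    proof -
      obtain t k where t: "t \<in> set us" and v: "v = face_row c \<tau> t k"
        using vW unfolding W_def edge_rows_def by auto
      have "face t i \<noteq> n" if "i < 4" for i
        using t us that face_eq_face_0[of t i] face_in_cells[of t T i] n' by blast
      then show ?thesis unfolding v by (rule face_row_eq_0)
    qed
    then show "v n = 0" using v out by blast
  qed
  then have main: "fls_const (1 / (\<Prod>e\<in>cells 1 T. c e) * P) * (1 / (?c s 2 3)\<^sup>2 * row_det (face s 0 # G)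
        ([face_row c \<tau> s 0, face_row c \<tau> s 1, face_row c \<tau> r 0, face_row c \<tau> r 1] @ W))
     \<doteq> fls_const (1 / (\<Prod>e\<in>cells 1 T. c e) * P) * (1 / (fls_const (c central_edge)) ^ 4 * row_det ([mid_face 2, mid_face 3, mid_face 4] @ G)
        ([face_row c \<tau>' tet4 2, face_row c \<tau>' tet4 3, face_row c \<tau>' tet2 2, face_row c \<tau>' tet2 3,
         face_row c \<tau>' tet3 2, face_row c \<tau>' tet3 3] @ W))"
    by (rule eq_up_to_unit_mult_left)
  have coeff: "fls_const (1 / Q) * (fls_const (1 / x * (1 / x * P)) * D) = fls_const (1 / Q * P) * (1 / (fls_const x)\<^sup>2 * D)"
    for Q x and D :: "complex fls"
  proof -
    have "1 / (fls_const x)\<^sup>2 = fls_const (1 / x * (1 / x))"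
      by (simp add: power2_eq_square fls_const_divide_const[symmetric])
    then show ?thesis by (simp add: mult_ac)
  qed
  \<comment> \<open>Three of the four factors come from the new tetrahedra, the fourth from the new
    edge.\<close>
  have coeff': "fls_const (1 / (x * Q)) * (fls_const (1 / x * (1 / x * (1 / x * P))) * D)
      = fls_const (1 / Q * P) * (1 / (fls_const x) ^ 4 * D)"
    for Q x and D :: "complex fls"
  proof -
    have "1 / (fls_const x) ^ 4 = fls_const (1 / x * (1 / x) * (1 / x) * (1 / x))"
      by (simp add: eval_nat_numeral mult.assoc fls_const_divide_const[symmetric])
    then show ?thesis by (simp add: mult_ac)
  qed
  show ?thesis
    using eq_up_to_unit_trans[OF left[unfolded edges_face_0 coeff] eq_up_to_unit_trans[OF main
      eq_up_to_unit_sym[OF right[unfolded W' coeff']]]] .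
qed

end

theorem theorem3p4:
  fixes M :: "'a::topological_space set"
    and Mt :: "'b::topological_space set"
    and p :: "'b \<Rightarrow> 'a"
    and act :: "int \<Rightarrow> 'b \<Rightarrow> 'b"
    and T T' :: "'a simplex_map set"
    and c :: "'a simplex_map \<Rightarrow> complex"
  assumes "compact_3_manifold M"
    and "manifold_boundary M \<noteq> {}"
    and "infinite_cyclic_cover M Mt p act"
    and "ideal_triangulation (manifold_interior M) T"
    and "pachner_2_3 T T'"
    and "ptolemy_assignment T c"
    and "ptolemy_assignment T' c"
    and "face_matrix_choices Mt p T L E rs fs"
    and "face_matrix_choices Mt p T' L' E' rs' fs'"
  shows "one_loop_polynomial act T c L E rs fs \<doteq> one_loop_polynomial act T' c L' E' rs' fs'"
proof -
  obtain s r where sr: "s \<in> T" "r \<in> T" "s \<noteq> r" "face s 0 = face r 0"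
    and T': "T' = T - {s, r} \<union> {subsimplex (bipyramid s r) [0, 1, 2, 3],
      subsimplex (bipyramid s r) [0, 1, 3, 4], subsimplex (bipyramid s r) [0, 1, 2, 4]}"
    using assms(5) unfolding pachner_2_3_def by blast
  interpret pachner_cover M Mt p act "manifold_interior M" T s r
    by unfold_locales (fact assms(3) assms(4) sr)+
  have "T' = local.T'"
    unfolding T' T'_def tet4_def tet2_def tet3_def ..
  then show ?thesis
    using one_loop_polynomial_pachner assms(6-9) by simp
qed

end
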